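(* For any positive integers $r$ and $s$, there is a tight chiral polyhedron of type $\{8r, 32s\}$.
   Context: An (abstract) polyhedron is a partially ordered set whose elements have rank $0$, $1$, $2$ (vertices, edges, faces), incidence meaning comparability, such that every edge is incident to exactly two vertices and two faces, whenever a vertex is incident to a face exactly two edges are incident to both, the incidence graph is connected, and for each vertex or face the subgraph of the incidence graph induced on its neighbours is connected. A flag is a mutually incident (vertex, edge, face) triple; $\Phi^i$ is the flag differing from $\Phi$ exactly in its rank-$i$ element. Type $\{p,q\}$: faces are incident to $p$ edges and vertices to $q$ edges. An automorphism is an incidence-preserving bijection. The polyhedron is chiral if its flags split into two classes with $\Phi,\Phi^i$ always in different classes and the automorphism group transitive on each class but not on all flags. A polyhedron of type $\{p,q\}$ is tight if it has exactly $2pq$ flags. *)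

theory Defs
  imports Complex_Main
begin

record 'a ranked_poset =
  elems :: "'a set"
  le_rel :: "'a rel"
  rk :: "'a \<Rightarrow> nat"

definition verts :: "'a ranked_poset \<Rightarrow> 'a set" where
  "verts P = {x \<in> elems P. rk P x = 0}"

definition edges :: "'a ranked_poset \<Rightarrow> 'a set" where
  "edges P = {x \<in> elems P. rk P x = 1}"

definition faces :: "'a ranked_poset \<Rightarrow> 'a set" where
  "faces P = {x \<in> elems P. rk P x = 2}"

definition incident :: "'a ranked_poset \<Rightarrow> 'a \<Rightarrow> 'a \<Rightarrow> bool" where
  "incident P x y \<longleftrightarrow> (x, y) \<in> le_rel P \<or> (y, x) \<in> le_rel P"

text \<open>Comparability is reflexive, whereas the incidence graph has no loops; hence \<open>y \<noteq> x\<close>.\<close>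

definition neighbours :: "'a ranked_poset \<Rightarrow> 'a \<Rightarrow> 'a set" where
  "neighbours P x = {y \<in> elems P. y \<noteq> x \<and> incident P x y}"

text \<open>The subgraph of the incidence graph induced on \<open>S\<close> is connected (in particular nonempty).\<close>

definition induced_connected :: "'a ranked_poset \<Rightarrow> 'a set \<Rightarrow> bool" where
  "induced_connected P S \<longleftrightarrow> S \<noteq> {} \<and>
     (\<forall>x\<in>S. \<forall>y\<in>S. (x, y) \<in> {(u, v). u \<in> S \<and> v \<in> S \<and> v \<in> neighbours P u}\<^sup>*)"

definition abstract_polyhedron :: "'a ranked_poset \<Rightarrow> bool" where
  "abstract_polyhedron P \<longleftrightarrow>
     partial_order_on (elems P) (le_rel P) \<and>
     (\<forall>x\<in>elems P. rk P x \<in> {0, 1, 2}) \<and>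
     (\<forall>x y. (x, y) \<in> le_rel P \<and> x \<noteq> y \<longrightarrow> rk P x < rk P y) \<and>
     (\<forall>e\<in>edges P. card {v \<in> verts P. incident P v e} = 2 \<and>
                   card {f \<in> faces P. incident P e f} = 2) \<and>
     (\<forall>v\<in>verts P. \<forall>f\<in>faces P. incident P v f \<longrightarrow>
        card {e \<in> edges P. incident P v e \<and> incident P e f} = 2) \<and>
     induced_connected P (elems P) \<and>
     (\<forall>x \<in> verts P \<union> faces P. induced_connected P (neighbours P x))"

definition flags :: "'a ranked_poset \<Rightarrow> ('a \<times> 'a \<times> 'a) set" where
  "flags P = {(v, e, f). v \<in> verts P \<and> e \<in> edges P \<and> f \<in> faces P \<and>
                incident P v e \<and> incident P e f \<and> incident P v f}"

fun flag_elem :: "'a \<times> 'a \<times> 'a \<Rightarrow> nat \<Rightarrow> 'a" where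
  "flag_elem (v, e, f) i = [v, e, f] ! i"

text \<open>\<open>\<Psi> = \<Phi>\<^sup>i\<close>, expressed as a relation; in a polyhedron exactly one such \<open>\<Psi>\<close> exists
  for each flag \<open>\<Phi>\<close> and each \<open>i \<le> 2\<close>.\<close>

definition adjacent_flags :: "'a ranked_poset \<Rightarrow> nat \<Rightarrow> 'a \<times> 'a \<times> 'a \<Rightarrow> 'a \<times> 'a \<times> 'a \<Rightarrow> bool" where
  "adjacent_flags P i \<Phi> \<Psi> \<longleftrightarrow> \<Phi> \<in> flags P \<and> \<Psi> \<in> flags P \<and>
     (\<forall>j\<le>2. flag_elem \<Phi> j \<noteq> flag_elem \<Psi> j \<longleftrightarrow> j = i)"

definition of_type :: "'a ranked_poset \<Rightarrow> nat \<Rightarrow> nat \<Rightarrow> bool" where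
  "of_type P p q \<longleftrightarrow>
     (\<forall>f\<in>faces P. finite {e \<in> edges P. incident P e f} \<and> card {e \<in> edges P. incident P e f} = p) \<and>
     (\<forall>v\<in>verts P. finite {e \<in> edges P. incident P v e} \<and> card {e \<in> edges P. incident P v e} = q)"

text \<open>Automorphisms respect ranks: dualities are not automorphisms. (For a polyhedron, a bijection
  that preserves incidence and maps one flag to a flag preserves all ranks.)\<close>

definition automorphism :: "'a ranked_poset \<Rightarrow> ('a \<Rightarrow> 'a) \<Rightarrow> bool" where
  "automorphism P g \<longleftrightarrow> bij_betw g (elems P) (elems P) \<and>
     (\<forall>x\<in>elems P. rk P (g x) = rk P x) \<and>
     (\<forall>x\<in>elems P. \<forall>y\<in>elems P. incident P (g x) (g y) \<longleftrightarrow> incident P x y)"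

definition flag_image :: "('a \<Rightarrow> 'a) \<Rightarrow> 'a \<times> 'a \<times> 'a \<Rightarrow> 'a \<times> 'a \<times> 'a" where
  "flag_image g = map_prod g (map_prod g g)"

definition transitive_on_flags :: "'a ranked_poset \<Rightarrow> ('a \<times> 'a \<times> 'a) set \<Rightarrow> bool" where
  "transitive_on_flags P C \<longleftrightarrow>
     (\<forall>\<Phi>\<in>C. \<forall>\<Psi>\<in>C. \<exists>g. automorphism P g \<and> flag_image g \<Phi> = \<Psi>)"

definition chiral :: "'a ranked_poset \<Rightarrow> bool" where
  "chiral P \<longleftrightarrow>
     (\<exists>A B. A \<union> B = flags P \<and> A \<inter> B = {} \<and>
        (\<forall>i\<le>2. \<forall>\<Phi> \<Psi>. adjacent_flags P i \<Phi> \<Psi> \<longrightarrow>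
           \<Phi> \<in> A \<and> \<Psi> \<in> B \<or> \<Phi> \<in> B \<and> \<Psi> \<in> A) \<and>
        transitive_on_flags P A \<and> transitive_on_flags P B \<and>
        \<not> transitive_on_flags P (flags P))"

definition tight_of_type :: "'a ranked_poset \<Rightarrow> nat \<Rightarrow> nat \<Rightarrow> bool" where
  "tight_of_type P p q \<longleftrightarrow> of_type P p q \<and> finite (flags P) \<and> card (flags P) = 2 * p * q"

end

theory Submission
  imports Defs "HOL-Library.Countable" "HOL-Number_Theory.Cong"
begin

text \<open>
  In a tight polyhedron of type \<open>{p, q}\<close> every vertex lies on every face, and the rotation group
  \<open>\<langle>x\<rangle>\<langle>y\<rangle>\<close> acts regularly on \<open>\<int>/p \<times> \<int>/q\<close>, the set of pairs (vertex, face): \<open>x\<close> acts as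
  \<open>(v, f) \<mapsto> (v + 1, \<kappa> f)\<close> and \<open>y\<close> as \<open>(v, f) \<mapsto> (\<pi> v, f + 1)\<close> for permutations \<open>\<pi>\<close>, \<open>\<kappa>\<close> fixing \<open>0\<close>.
  Conversely, such a pair gives a tight polyhedron as soon as the powers of \<open>\<pi>\<close> and \<open>\<kappa>\<close> form a
  reciprocal pair of skew morphisms with \<open>\<pi> 1 = -1\<close> and \<open>\<kappa> 1 = -1\<close>. A reflection would have to
  act by negation on vertices and faces, which forces \<open>\<kappa> (- \<kappa> f) = - f\<close>.

  For \<open>q = 32 s\<close> take \<open>\<kappa> f = - f + 4 s f (1 - f)\<close>, which violates this identity at \<open>f = 2\<close>.
  If the \<open>2\<close>-part of \<open>p = 8 r\<close> divides \<open>32 s\<close>, let \<open>\<pi>\<close> be \<open>a \<mapsto> a + 4 s a\<close> on even and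
  \<open>a \<mapsto> a - 2 - 4 s (a - 1)\<close> on odd residues modulo the \<open>2\<close>-part of \<open>p\<close>, and negation modulo the
  odd part. Otherwise the roles of \<open>p\<close> and \<open>q\<close> can be exchanged, and the dual polyhedron has the
  required type.
\<close>

section \<open>Polyhedra in which every vertex lies on every face\<close>

text \<open>Vertices, edges and faces share the carrier type \<open>nat\<close>; the residue modulo
  3 records the rank, so \<open>rk\<close> can be \<open>x mod 3\<close> and the three code ranges
  are disjoint.\<close>

definition vcode :: "int \<Rightarrow> nat" where "vcode v = 3 * to_nat v"
definition ecode :: "int \<times> int \<Rightarrow> nat" where "ecode d = 3 * to_nat d + 1"
definition fcode :: "int \<Rightarrow> nat" where "fcode f = 3 * to_nat f + 2"

lemma code_eq [simp]:
  "vcode v = vcode w \<longleftrightarrow> v = w" "ecode d = ecode e \<longleftrightarrow> d = e" "fcode f = fcode g \<longleftrightarrow> f = g"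
  "vcode v \<noteq> ecode d" "vcode v \<noteq> fcode f" "ecode d \<noteq> fcode f"
  "ecode d \<noteq> vcode v" "fcode f \<noteq> vcode v" "fcode f \<noteq> ecode d"
  unfolding vcode_def ecode_def fcode_def by (auto, presburger+)

lemma code_mod [simp]:
  "vcode v mod 3 = 0" "ecode d mod 3 = 1" "fcode f mod 3 = 2"
  "3 dvd vcode v" "\<not> 3 dvd ecode d" "\<not> 3 dvd fcode f"
  "ecode d mod 3 = Suc 0"
  unfolding vcode_def ecode_def fcode_def by presburger+

lemma code_div [simp]: "vcode v div 3 = to_nat v" "ecode d div 3 = to_nat d" "fcode f div 3 = to_nat f"
  unfolding vcode_def ecode_def fcode_def by simp_all

text \<open>A pair \<open>(v, f)\<close> is a dart: it stands for the edge that leaves \<open>v\<close> with \<open>f\<close> on its left. The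
  two darts of an edge are exchanged by \<open>opp\<close>, and \<open>rh v\<close> rotates the faces around \<open>v\<close>.
  Edges are represented by the one of their two darts whose vertex is even.\<close>

locale flat_map =
  fixes V F :: "int set"
    and opp :: "int \<times> int \<Rightarrow> int \<times> int"
    and rh :: "int \<Rightarrow> int \<Rightarrow> int"
  assumes finite_V: "finite V" and finite_F: "finite F" and V_ne: "V \<noteq> {}" and F_ne: "F \<noteq> {}"
    and opp_in: "d \<in> V \<times> F \<Longrightarrow> opp d \<in> V \<times> F"
    and opp_opp: "d \<in> V \<times> F \<Longrightarrow> opp (opp d) = d"
    and opp_parity: "d \<in> V \<times> F \<Longrightarrow> even (fst (opp d)) \<longleftrightarrow> odd (fst d)"
    and rh_in: "v \<in> V \<Longrightarrow> f \<in> F \<Longrightarrow> rh v f \<in> F"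
    and rh_neq: "v \<in> V \<Longrightarrow> f \<in> F \<Longrightarrow> rh v f \<noteq> f"
    and opp_rh: "v \<in> V \<Longrightarrow> f \<in> F \<Longrightarrow> snd (opp (v, rh v f)) = f"
    and rh_opp: "v \<in> V \<Longrightarrow> f \<in> F \<Longrightarrow> rh v (snd (opp (v, f))) = f"
    and face_cycle: "f \<in> F \<Longrightarrow> v \<in> V \<Longrightarrow> w \<in> V \<Longrightarrow> \<exists>n. w = ((\<lambda>u. fst (opp (u, f))) ^^ n) v"
    and vertex_cycle: "v \<in> V \<Longrightarrow> f \<in> F \<Longrightarrow> g \<in> F \<Longrightarrow> \<exists>n. g = (rh v ^^ n) f"
begin

definition edge :: "int \<times> int \<Rightarrow> int \<times> int" where
  "edge d = (if even (fst d) then d else opp d)"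

definition E :: "(int \<times> int) set" where "E = {d \<in> V \<times> F. even (fst d)}"

text \<open>The vertex-face relation is complete, so transitivity along a chain vertex, edge, face
  is automatic.\<close>

definition poly :: "nat ranked_poset" where
  "poly = \<lparr>elems = vcode ` V \<union> ecode ` E \<union> fcode ` F,
     le_rel = Id_on (vcode ` V \<union> ecode ` E \<union> fcode ` F)
       \<union> {(vcode v, ecode e) | v e. e \<in> E \<and> (v = fst e \<or> v = fst (opp e))}
       \<union> {(ecode e, fcode f) | e f. e \<in> E \<and> (f = snd e \<or> f = snd (opp e))}
       \<union> {(vcode v, fcode f) | v f. v \<in> V \<and> f \<in> F},
     rk = \<lambda>x. x mod 3\<rparr>"

lemma rk_poly [simp]: "rk poly x = x mod 3"
  by (simp add: poly_def)

lemma elems_poly: "elems poly = vcode ` V \<union> ecode ` E \<union> fcode ` F"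
  by (simp add: poly_def)

lemma verts_poly: "verts poly = vcode ` V"
  and edges_poly: "edges poly = ecode ` E"
  and faces_poly: "faces poly = fcode ` F"
  unfolding verts_def edges_def faces_def elems_poly by auto

lemma incident_poly [simp]:
  "incident poly (vcode v) (vcode w) \<longleftrightarrow> v \<in> V \<and> v = w"
  "incident poly (ecode d) (ecode e) \<longleftrightarrow> e \<in> E \<and> d = e"
  "incident poly (fcode f) (fcode g) \<longleftrightarrow> f \<in> F \<and> f = g"
  "incident poly (vcode v) (ecode e) \<longleftrightarrow> e \<in> E \<and> (v = fst e \<or> v = fst (opp e))"
  "incident poly (ecode e) (vcode v) \<longleftrightarrow> e \<in> E \<and> (v = fst e \<or> v = fst (opp e))"
  "incident poly (ecode e) (fcode f) \<longleftrightarrow> e \<in> E \<and> (f = snd e \<or> f = snd (opp e))"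
  "incident poly (fcode f) (ecode e) \<longleftrightarrow> e \<in> E \<and> (f = snd e \<or> f = snd (opp e))"
  "incident poly (vcode v) (fcode f) \<longleftrightarrow> v \<in> V \<and> f \<in> F"
  "incident poly (fcode f) (vcode v) \<longleftrightarrow> v \<in> V \<and> f \<in> F"
  unfolding incident_def poly_def by (auto simp: Id_on_def simp del: split_paired_Ex)

section \<open>Edges as pairs of darts, and the edges at a vertex, a face or both\<close>

lemma fst_opp_neq: "d \<in> V \<times> F \<Longrightarrow> fst (opp d) \<noteq> fst d"
  using opp_parity by metis

text \<open>\<open>rh\<close> undoes the face component of \<open>opp\<close> and has no fixed
  point, so an edge has different faces on its two sides.\<close>

lemma snd_opp_neq: "d \<in> V \<times> F \<Longrightarrow> snd (opp d) \<noteq> snd d"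
  using rh_opp rh_neq opp_in by (metis SigmaE fst_conv mem_Times_iff snd_conv)

lemma edge_in: "d \<in> V \<times> F \<Longrightarrow> edge d \<in> E"
  unfolding edge_def E_def using opp_in opp_parity by auto

lemma edge_of_E: "e \<in> E \<Longrightarrow> edge e = e"
  unfolding edge_def E_def by auto

lemma E_subset: "e \<in> E \<Longrightarrow> e \<in> V \<times> F"
  unfolding E_def by auto

lemma edge_cases: "edge d = d \<or> edge d = opp d"
  unfolding edge_def by auto

lemma edge_opp: "d \<in> V \<times> F \<Longrightarrow> edge (opp d) = edge d"
  unfolding edge_def using opp_opp opp_parity by auto

lemma edge_eq_iff:
  assumes "d \<in> V \<times> F" "d' \<in> V \<times> F"
  shows "edge d = edge d' \<longleftrightarrow> d = d' \<or> d = opp d'"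
  using assms edge_cases edge_opp opp_opp by metis

lemma vertex_on_edge:
  "d \<in> V \<times> F \<Longrightarrow> v = fst (edge d) \<or> v = fst (opp (edge d)) \<longleftrightarrow> v = fst d \<or> v = fst (opp d)"
  using edge_cases[of d] opp_opp by auto

lemma face_on_edge:
  "d \<in> V \<times> F \<Longrightarrow> f = snd (edge d) \<or> f = snd (opp (edge d)) \<longleftrightarrow> f = snd d \<or> f = snd (opp d)"
  using edge_cases[of d] opp_opp by auto

lemma edges_at_vertex:
  assumes "v \<in> V"
  shows "{e \<in> E. v = fst e \<or> v = fst (opp e)} = edge ` ({v} \<times> F)"
proof (intro set_eqI iffI)
  fix e assume "e \<in> {e \<in> E. v = fst e \<or> v = fst (opp e)}"
  then have e: "e \<in> E" "v = fst e \<or> v = fst (opp e)" by auto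
  then have "e \<in> V \<times> F" "edge e = e" using E_subset edge_of_E by auto
  then show "e \<in> edge ` ({v} \<times> F)"
    using e opp_in edge_opp by (metis image_eqI mem_Times_iff singletonI)
next
  fix e assume "e \<in> edge ` ({v} \<times> F)"
  then show "e \<in> {e \<in> E. v = fst e \<or> v = fst (opp e)}"
    using assms edge_in vertex_on_edge by fastforce
qed

lemma edges_at_face:
  assumes "f \<in> F"
  shows "{e \<in> E. f = snd e \<or> f = snd (opp e)} = edge ` (V \<times> {f})"
proof (intro set_eqI iffI)
  fix e assume "e \<in> {e \<in> E. f = snd e \<or> f = snd (opp e)}"
  then have e: "e \<in> E" "f = snd e \<or> f = snd (opp e)" by auto
  then have "e \<in> V \<times> F" "edge e = e" using E_subset edge_of_E by auto
  then show "e \<in> edge ` (V \<times> {f})"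
    using e opp_in edge_opp by (metis image_eqI mem_Times_iff singletonI)
next
  fix e assume "e \<in> edge ` (V \<times> {f})"
  then show "e \<in> {e \<in> E. f = snd e \<or> f = snd (opp e)}"
    using assms edge_in face_on_edge by fastforce
qed

text \<open>The two darts of an edge start at different vertices, so only one of them can start at
  \<open>v\<close>; the edges at \<open>v\<close> are thereby indexed by the faces.\<close>

lemma inj_on_edge_vertex: "v \<in> V \<Longrightarrow> inj_on edge ({v} \<times> F)"
  by (intro inj_onI) (metis SigmaE edge_eq_iff fst_conv fst_opp_neq mem_Sigma_iff singletonD)

lemma inj_on_edge_face: "f \<in> F \<Longrightarrow> inj_on edge (V \<times> {f})"
  by (intro inj_onI) (metis SigmaE edge_eq_iff snd_conv snd_opp_neq mem_Sigma_iff singletonD)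

text \<open>The sides of \<open>edge (v, g)\<close> are \<open>g\<close> and its predecessor around
  \<open>v\<close>, so this edge borders \<open>f\<close> precisely for \<open>g = f\<close> and
  \<open>g = rh v f\<close>. Both the diamond condition and the two flag classes come from
  here.\<close>

lemma edges_at_flag:
  assumes "v \<in> V" "f \<in> F"
  shows "e \<in> E \<and> (v = fst e \<or> v = fst (opp e)) \<and> (f = snd e \<or> f = snd (opp e)) \<longleftrightarrow>
    e = edge (v, f) \<or> e = edge (v, rh v f)"
proof
  assume L: "e \<in> E \<and> (v = fst e \<or> v = fst (opp e)) \<and> (f = snd e \<or> f = snd (opp e))"
  then obtain g where g: "g \<in> F" "e = edge (v, g)" using edges_at_vertex[OF assms(1)] by blast
  then have "f = g \<or> f = snd (opp (v, g))" using L assms face_on_edge[of "(v, g)" f] by auto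
  then show "e = edge (v, f) \<or> e = edge (v, rh v f)" using g assms rh_opp by auto
next
  assume "e = edge (v, f) \<or> e = edge (v, rh v f)"
  then show "e \<in> E \<and> (v = fst e \<or> v = fst (opp e)) \<and> (f = snd e \<or> f = snd (opp e))"
    using assms edge_in rh_in opp_rh vertex_on_edge face_on_edge
    by (metis (no_types, lifting) fst_conv mem_Sigma_iff snd_conv)
qed

lemma edge_rh_neq: "v \<in> V \<Longrightarrow> f \<in> F \<Longrightarrow> edge (v, rh v f) \<noteq> edge (v, f)"
  using inj_on_edge_vertex[of v] rh_in[of v f] rh_neq[of v f] by (auto simp: inj_on_def)

section \<open>The axioms of an abstract polyhedron\<close>

lemma partial_order_poly: "partial_order_on (elems poly) (le_rel poly)"
proof -
  have "e \<in> E \<Longrightarrow> fst e \<in> V \<and> snd e \<in> F \<and> fst (opp e) \<in> V \<and> snd (opp e) \<in> F" for e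
    using E_subset opp_in by (metis mem_Times_iff)
  then show ?thesis
    unfolding partial_order_on_def preorder_on_def refl_on_def trans_on_def antisym_on_def elems_poly
    by (simp add: poly_def Id_on_def) (safe; force)
qed

text \<open>Since every vertex is incident to every face, any element reaches the fixed face
  \<open>f0\<close> in at most two steps.\<close>

lemma connected_poly: "induced_connected poly (elems poly)"
proof -
  define R where "R = {(u, v). u \<in> elems poly \<and> v \<in> elems poly \<and> v \<in> neighbours poly u}"
  obtain v0 f0 where v0: "v0 \<in> V" and f0: "f0 \<in> F" using V_ne F_ne by auto
  have vf: "(vcode v, fcode f) \<in> R" "(fcode f, vcode v) \<in> R" if "v \<in> V" "f \<in> F" for v f
    using that by (auto simp: R_def elems_poly neighbours_def)
  have ve: "(vcode (fst e), ecode e) \<in> R" "(ecode e, vcode (fst e)) \<in> R" "fst e \<in> V" if "e \<in> E" for e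
    using that E_subset[OF that] by (auto simp: R_def elems_poly neighbours_def)
  have f0R: "(fcode f0, x) \<in> R\<^sup>* \<and> (x, fcode f0) \<in> R\<^sup>*" if "x \<in> elems poly" for x
  proof -
    consider v where "v \<in> V" "x = vcode v" | e where "e \<in> E" "x = ecode e"
      | f where "f \<in> F" "x = fcode f" using \<open>x \<in> elems poly\<close> by (auto simp: elems_poly)
    then show ?thesis
    proof cases
      case 1 then show ?thesis using vf f0 by blast
    next
      case 2 then show ?thesis
        using ve[of e] vf[OF _ f0, of "fst e"] by (meson r_into_rtrancl rtrancl.rtrancl_into_rtrancl converse_rtrancl_into_rtrancl)
    next
      case 3 then show ?thesis
        using vf[OF v0 f0] vf[OF v0, of f] by (meson r_into_rtrancl rtrancl.rtrancl_into_rtrancl)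
    qed
  qed
  have "elems poly \<noteq> {}" using V_ne by (auto simp: elems_poly)
  then show ?thesis unfolding induced_connected_def R_def[symmetric] using f0R by (meson rtrancl_trans)
qed

lemma neighbours_vertex:
  assumes "v \<in> V"
  shows "neighbours poly (vcode v) = ecode ` edge ` ({v} \<times> F) \<union> fcode ` F"
  using assms by (auto simp: neighbours_def elems_poly edges_at_vertex[symmetric])

lemma neighbours_face:
  assumes "f \<in> F"
  shows "neighbours poly (fcode f) = ecode ` edge ` (V \<times> {f}) \<union> vcode ` V"
  using assms by (auto simp: neighbours_def elems_poly edges_at_face[symmetric])

text \<open>The faces \<open>f\<close> and \<open>rh v f\<close> are joined through the edge between
  them, and by \<open>vertex_cycle\<close> the rotation about \<open>v\<close> reaches all
  faces.\<close>

lemma connected_vertex: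
  assumes "v \<in> V"
  shows "induced_connected poly (neighbours poly (vcode v))"
proof -
  let ?N = "neighbours poly (vcode v)"
  define R where "R = {(x, y). x \<in> ?N \<and> y \<in> ?N \<and> y \<in> neighbours poly x}"
  have mem: "ecode (edge (v, f)) \<in> ?N" "fcode f \<in> ?N" if "f \<in> F" for f
    using that neighbours_vertex[OF assms] by auto
  have inc: "(ecode (edge (v, f)), fcode g) \<in> R \<and> (fcode g, ecode (edge (v, f))) \<in> R"
    if "f \<in> F" "g = f \<or> rh v g = f" "g \<in> F" for f g
  proof -
    have "g = snd (edge (v, f)) \<or> g = snd (opp (edge (v, f)))"
      using face_on_edge[of "(v, f)" g] that assms opp_rh by auto
    moreover have "edge (v, f) \<in> E" using edge_in assms that by auto
    ultimately show ?thesis using mem that by (auto simp: R_def neighbours_def elems_poly)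
  qed
  have step: "(fcode f, fcode (rh v f)) \<in> R\<^sup>*" if "f \<in> F" for f
    using inc[of "rh v f" f] inc[of "rh v f" "rh v f"] that assms rh_in
    by (meson r_into_rtrancl rtrancl.rtrancl_into_rtrancl)
  have pow: "(rh v ^^ n) f \<in> F \<and> (fcode f, fcode ((rh v ^^ n) f)) \<in> R\<^sup>*" if "f \<in> F" for n f
    by (induction n) (use that assms rh_in step in \<open>auto intro: rtrancl_trans\<close>)
  have ff: "(fcode f, fcode g) \<in> R\<^sup>*" if "f \<in> F" "g \<in> F" for f g
    using vertex_cycle[OF assms that] pow[OF that(1)] by auto
  obtain f0 where f0: "f0 \<in> F" using F_ne by auto
  have f0R: "(fcode f0, x) \<in> R\<^sup>* \<and> (x, fcode f0) \<in> R\<^sup>*" if "x \<in> ?N" for x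
  proof -
    have "(\<exists>f\<in>F. x = fcode f) \<or> (\<exists>f\<in>F. x = ecode (edge (v, f)))"
      using that neighbours_vertex[OF assms] by auto
    then show ?thesis
    proof
      assume "\<exists>f\<in>F. x = fcode f" then show ?thesis using ff f0 by auto
    next
      assume "\<exists>f\<in>F. x = ecode (edge (v, f))"
      then obtain f where f: "f \<in> F" "x = ecode (edge (v, f))" by auto
      then show ?thesis using inc[of f f] ff[OF f0 f(1)] ff[OF f(1) f0]
        by (auto intro: rtrancl_into_rtrancl converse_rtrancl_into_rtrancl)
    qed
  qed
  have "?N \<noteq> {}" using mem f0 by blast
  then show ?thesis unfolding induced_connected_def R_def[symmetric] using f0R by (meson rtrancl_trans)
qed

text \<open>The vertices \<open>u\<close> and \<open>fst (opp (u, f))\<close> are the ends of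
  \<open>edge (u, f)\<close>, and by \<open>face_cycle\<close> this walk along the boundary of
  \<open>f\<close> visits all vertices.\<close>

lemma connected_face:
  assumes "f \<in> F"
  shows "induced_connected poly (neighbours poly (fcode f))"
proof -
  let ?N = "neighbours poly (fcode f)"
  define R where "R = {(x, y). x \<in> ?N \<and> y \<in> ?N \<and> y \<in> neighbours poly x}"
  let ?s = "\<lambda>u. fst (opp (u, f))"
  have mem: "ecode (edge (v, f)) \<in> ?N" "vcode v \<in> ?N" if "v \<in> V" for v
    using that neighbours_face[OF assms] by auto
  have s_in: "?s v \<in> V" if "v \<in> V" for v
    using that assms opp_in by (metis mem_Sigma_iff mem_Times_iff)
  have inc: "(ecode (edge (v, f)), vcode w) \<in> R \<and> (vcode w, ecode (edge (v, f))) \<in> R"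
    if "v \<in> V" "w = v \<or> w = ?s v" for v w
  proof -
    have "w = fst (edge (v, f)) \<or> w = fst (opp (edge (v, f)))"
      using vertex_on_edge[of "(v, f)" w] that assms by auto
    moreover have "edge (v, f) \<in> E" "w \<in> V" using edge_in assms that s_in by auto
    ultimately show ?thesis using mem that by (auto simp: R_def neighbours_def elems_poly)
  qed
  have step: "(vcode v, vcode (?s v)) \<in> R\<^sup>*" if "v \<in> V" for v
    using inc[of v v] inc[of v "?s v"] that by (meson r_into_rtrancl rtrancl.rtrancl_into_rtrancl)
  have pow: "(?s ^^ n) v \<in> V \<and> (vcode v, vcode ((?s ^^ n) v)) \<in> R\<^sup>*" if "v \<in> V" for n v
  proof (induction n)
    case 0 then show ?case using that by simp
  next
    case (Suc n) then show ?case using s_in[of "(?s ^^ n) v"] step[of "(?s ^^ n) v"]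
      by (auto intro: rtrancl_trans)
  qed
  have vv: "(vcode v, vcode w) \<in> R\<^sup>*" if "v \<in> V" "w \<in> V" for v w
    using face_cycle[OF assms that] pow[OF that(1)] by auto
  obtain v0 where v0: "v0 \<in> V" using V_ne by auto
  have v0R: "(vcode v0, x) \<in> R\<^sup>* \<and> (x, vcode v0) \<in> R\<^sup>*" if "x \<in> ?N" for x
  proof -
    have "(\<exists>v\<in>V. x = vcode v) \<or> (\<exists>v\<in>V. x = ecode (edge (v, f)))"
      using that neighbours_face[OF assms] by auto
    then show ?thesis
    proof
      assume "\<exists>v\<in>V. x = vcode v" then show ?thesis using vv v0 by auto
    next
      assume "\<exists>v\<in>V. x = ecode (edge (v, f))"
      then obtain v where v: "v \<in> V" "x = ecode (edge (v, f))" by auto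
      then show ?thesis using inc[of v v] vv[OF v0 v(1)] vv[OF v(1) v0]
        by (auto intro: rtrancl_into_rtrancl converse_rtrancl_into_rtrancl)
    qed
  qed
  have "?N \<noteq> {}" using mem v0 by blast
  then show ?thesis unfolding induced_connected_def R_def[symmetric] using v0R by (meson rtrancl_trans)
qed

lemma card_edge_ends:
  assumes "e \<in> E"
  shows "card {v \<in> verts poly. incident poly v (ecode e)} = 2"
    and "card {f \<in> faces poly. incident poly (ecode e) f} = 2"
proof -
  have e: "e \<in> V \<times> F" "opp e \<in> V \<times> F" using assms E_subset opp_in by auto
  have "{v \<in> verts poly. incident poly v (ecode e)} = {vcode (fst e), vcode (fst (opp e))}"
    using assms e by (auto simp: verts_poly)
  then show "card {v \<in> verts poly. incident poly v (ecode e)} = 2"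
    using fst_opp_neq[OF e(1)] fst_opp_neq[OF e(1), symmetric] by simp
  have "{f \<in> faces poly. incident poly (ecode e) f} = {fcode (snd e), fcode (snd (opp e))}"
    using assms e by (auto simp: faces_poly)
  then show "card {f \<in> faces poly. incident poly (ecode e) f} = 2"
    using snd_opp_neq[OF e(1)] snd_opp_neq[OF e(1), symmetric] by simp
qed

lemma card_flag_edges:
  assumes "v \<in> V" "f \<in> F"
  shows "card {e \<in> edges poly. incident poly (vcode v) e \<and> incident poly e (fcode f)} = 2"
proof -
  have "{e \<in> edges poly. incident poly (vcode v) e \<and> incident poly e (fcode f)}
      = ecode ` {e. e \<in> E \<and> (v = fst e \<or> v = fst (opp e)) \<and> (f = snd e \<or> f = snd (opp e))}"
    by (auto simp: edges_poly simp del: split_paired_Ex split_paired_All)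
  also have "\<dots> = ecode ` {edge (v, f), edge (v, rh v f)}"
    unfolding edges_at_flag[OF assms] by blast
  finally have "{e \<in> edges poly. incident poly (vcode v) e \<and> incident poly e (fcode f)}
      = {ecode (edge (v, f)), ecode (edge (v, rh v f))}" by simp
  then show ?thesis using edge_rh_neq[OF assms] edge_rh_neq[OF assms, symmetric] by simp
qed

lemma abstract_polyhedron_poly: "abstract_polyhedron poly"
proof -
  have "\<forall>x y. (x, y) \<in> le_rel poly \<and> x \<noteq> y \<longrightarrow> rk poly x < rk poly y"
    by (auto simp: poly_def)
  moreover have "\<forall>x\<in>elems poly. rk poly x \<in> {0, 1, 2}" by (auto simp: elems_poly)
  moreover have "\<forall>e\<in>edges poly. card {v \<in> verts poly. incident poly v e} = 2 \<and>
      card {f \<in> faces poly. incident poly e f} = 2"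
    unfolding edges_poly using card_edge_ends by blast
  moreover have "\<forall>v\<in>verts poly. \<forall>f\<in>faces poly. incident poly v f \<longrightarrow>
      card {e \<in> edges poly. incident poly v e \<and> incident poly e f} = 2"
    unfolding verts_poly faces_poly using card_flag_edges by blast
  moreover have "\<forall>x \<in> verts poly \<union> faces poly. induced_connected poly (neighbours poly x)"
    unfolding verts_poly faces_poly using connected_vertex connected_face by blast
  ultimately show ?thesis
    unfolding abstract_polyhedron_def using partial_order_poly connected_poly by blast
qed

section \<open>Type, flags and tightness\<close>

lemma of_type_poly: "of_type poly (card V) (card F)"
proof -
  have f: "finite {e \<in> edges poly. incident poly e (fcode f)} \<and>
      card {e \<in> edges poly. incident poly e (fcode f)} = card V" if "f \<in> F" for f
  proof -
    have "{e \<in> edges poly. incident poly e (fcode f)} = ecode ` {e \<in> E. f = snd e \<or> f = snd (opp e)}"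
      by (auto simp: edges_poly simp del: split_paired_Ex split_paired_All)
    also have "\<dots> = (ecode \<circ> edge) ` (V \<times> {f})"
      using edges_at_face[OF that] by (simp add: image_comp)
    finally have eq: "{e \<in> edges poly. incident poly e (fcode f)} = (ecode \<circ> edge) ` (V \<times> {f})" .
    have "inj_on (ecode \<circ> edge) (V \<times> {f})"
      using inj_on_edge_face[OF that] by (simp add: inj_on_def)
    then show ?thesis unfolding eq using finite_V by (subst card_image) (auto simp: card_cartesian_product)
  qed
  have v: "finite {e \<in> edges poly. incident poly (vcode v) e} \<and>
      card {e \<in> edges poly. incident poly (vcode v) e} = card F" if "v \<in> V" for v
  proof -
    have "{e \<in> edges poly. incident poly (vcode v) e} = ecode ` {e \<in> E. v = fst e \<or> v = fst (opp e)}"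
      by (auto simp: edges_poly simp del: split_paired_Ex split_paired_All)
    also have "\<dots> = (ecode \<circ> edge) ` ({v} \<times> F)"
      using edges_at_vertex[OF that] by (simp add: image_comp)
    finally have eq: "{e \<in> edges poly. incident poly (vcode v) e} = (ecode \<circ> edge) ` ({v} \<times> F)" .
    have "inj_on (ecode \<circ> edge) ({v} \<times> F)"
      using inj_on_edge_vertex[OF that] by (simp add: inj_on_def)
    then show ?thesis unfolding eq using finite_F by (subst card_image) (auto simp: card_cartesian_product)
  qed
  show ?thesis unfolding of_type_def faces_poly verts_poly using f v by blast
qed

text \<open>Each pair \<open>(v, f)\<close> lies in two flags: seen from \<open>v\<close>, the edge
  has \<open>f\<close> on its left in \<open>pos_flag\<close> and on its right in
  \<open>neg_flag\<close>. These are the two orientation classes.\<close>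

definition pos_flag :: "int \<times> int \<Rightarrow> nat \<times> nat \<times> nat" where
  "pos_flag d = (vcode (fst d), ecode (edge d), fcode (snd d))"

definition neg_flag :: "int \<times> int \<Rightarrow> nat \<times> nat \<times> nat" where
  "neg_flag d = (vcode (fst d), ecode (edge (fst d, rh (fst d) (snd d))), fcode (snd d))"

lemma flags_poly: "flags poly = pos_flag ` (V \<times> F) \<union> neg_flag ` (V \<times> F)"
proof (intro set_eqI iffI)
  fix \<Phi> assume "\<Phi> \<in> flags poly"
  then obtain v e f where \<Phi>: "\<Phi> = (vcode v, ecode e, fcode f)" "v \<in> V" "e \<in> E" "f \<in> F"
    "v = fst e \<or> v = fst (opp e)" "f = snd e \<or> f = snd (opp e)"
    by (auto simp: flags_def verts_poly edges_poly faces_poly)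
  then have "e = edge (v, f) \<or> e = edge (v, rh v f)" using edges_at_flag by blast
  then have "\<Phi> = pos_flag (v, f) \<or> \<Phi> = neg_flag (v, f)"
    using \<Phi>(1) by (auto simp: pos_flag_def neg_flag_def)
  then show "\<Phi> \<in> pos_flag ` (V \<times> F) \<union> neg_flag ` (V \<times> F)" using \<Phi>(2,4) by blast
next
  fix \<Phi> assume "\<Phi> \<in> pos_flag ` (V \<times> F) \<union> neg_flag ` (V \<times> F)"
  then obtain v f where vf: "v \<in> V" "f \<in> F" "\<Phi> = pos_flag (v, f) \<or> \<Phi> = neg_flag (v, f)" by auto
  define e where "e = edge (v, if \<Phi> = pos_flag (v, f) then f else rh v f)"
  have "\<Phi> = (vcode v, ecode e, fcode f)"
    using vf by (auto simp: e_def pos_flag_def neg_flag_def)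
  moreover have "e \<in> E \<and> (v = fst e \<or> v = fst (opp e)) \<and> (f = snd e \<or> f = snd (opp e))"
    using edges_at_flag[OF vf(1,2)] by (simp add: e_def)
  ultimately show "\<Phi> \<in> flags poly"
    using vf by (auto simp: flags_def verts_poly edges_poly faces_poly)
qed

lemma pos_neg_disjoint: "pos_flag ` (V \<times> F) \<inter> neg_flag ` (V \<times> F) = {}"
  using edge_rh_neq by (auto simp: pos_flag_def neg_flag_def) metis

lemma tight_poly: "tight_of_type poly (card V) (card F)"
proof -
  have "inj_on pos_flag (V \<times> F)" "inj_on neg_flag (V \<times> F)"
    by (auto simp: inj_on_def pos_flag_def neg_flag_def)
  then have "card (flags poly) = card (V \<times> F) + card (V \<times> F)"
    unfolding flags_poly using finite_V finite_F pos_neg_disjoint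
    by (subst card_Un_disjoint) (auto simp: card_image)
  then show ?thesis
    unfolding tight_of_type_def using of_type_poly finite_V finite_F
    by (auto simp: flags_poly card_cartesian_product)
qed

text \<open>Suppose both flags lie in one class. If their edges agree, the underlying darts are
  equal or opposite, and opposite darts differ in vertex and face at once. If the edges differ,
  vertex and face agree, but within a class these determine the edge.\<close>

lemma adjacent_pos_neg:
  assumes "adjacent_flags poly i \<Phi> \<Psi>" "i \<le> 2"
  shows "\<Phi> \<in> pos_flag ` (V \<times> F) \<and> \<Psi> \<in> neg_flag ` (V \<times> F) \<or>
    \<Phi> \<in> neg_flag ` (V \<times> F) \<and> \<Psi> \<in> pos_flag ` (V \<times> F)"
proof -
  have \<Phi>\<Psi>: "\<Phi> \<in> flags poly" "\<Psi> \<in> flags poly" using assms by (auto simp: adjacent_flags_def)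
  obtain v e f v' e' f' where eq: "\<Phi> = (v, e, f)" "\<Psi> = (v', e', f')" by (cases \<Phi>, cases \<Psi>) auto
  have "\<forall>j\<le>2. flag_elem \<Phi> j \<noteq> flag_elem \<Psi> j \<longleftrightarrow> j = i"
    using assms by (auto simp: adjacent_flags_def)
  from this[rule_format, of 0] this[rule_format, of 1] this[rule_format, of 2]
  have adj: "v \<noteq> v' \<longleftrightarrow> i = 0" "e \<noteq> e' \<longleftrightarrow> i = 1" "f \<noteq> f' \<longleftrightarrow> i = 2"
    using eq by (auto simp: eval_nat_numeral)
  have "\<not> (\<Phi> \<in> pos_flag ` (V \<times> F) \<and> \<Psi> \<in> pos_flag ` (V \<times> F))"
  proof (intro notI, elim conjE imageE)
    fix d d' assume d: "d \<in> V \<times> F" "d' \<in> V \<times> F" "\<Phi> = pos_flag d" "\<Psi> = pos_flag d'"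
    show False
    proof (cases "e = e'")
      case False
      then show ?thesis using adj d eq by (auto simp: pos_flag_def prod_eq_iff)
    next
      case True
      then have "d = d' \<or> d = opp d'" using d eq edge_eq_iff by (auto simp: pos_flag_def)
      then show ?thesis
      proof
        assume "d = d'" then show False using adj assms(2) d eq True by (auto simp: pos_flag_def)
      next
        assume "d = opp d'"
        then have "v \<noteq> v'" "f \<noteq> f'" using fst_opp_neq snd_opp_neq d eq by (auto simp: pos_flag_def)
        then show False using adj by simp
      qed
    qed
  qed
  moreover have "\<not> (\<Phi> \<in> neg_flag ` (V \<times> F) \<and> \<Psi> \<in> neg_flag ` (V \<times> F))"
  proof (intro notI, elim conjE imageE)
    fix d d' assume d: "d \<in> V \<times> F" "d' \<in> V \<times> F" "\<Phi> = neg_flag d" "\<Psi> = neg_flag d'"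
    \<comment> \<open>\<open>neg_flag d\<close> uses the edge of the dart \<open>?r d\<close>; by
      \<open>opp_rh\<close> the face of \<open>d\<close> is recovered as the far side of that
      dart.\<close>
    let ?r = "\<lambda>d. (fst d, rh (fst d) (snd d))"
    have rd: "?r d \<in> V \<times> F" "?r d' \<in> V \<times> F" using d rh_in by auto
    show False
    proof (cases "e = e'")
      case False
      then show ?thesis using adj d eq by (auto simp: neg_flag_def prod_eq_iff)
    next
      case True
      then have "?r d = ?r d' \<or> ?r d = opp (?r d')"
        using d eq edge_eq_iff[OF rd] by (auto simp: neg_flag_def)
      then show ?thesis
      proof
        assume r: "?r d = ?r d'"
        then have "snd d = snd d'" using opp_rh d(1,2) by (metis mem_Times_iff)
        with r have "d = d'" by (simp add: prod_eq_iff)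
        then show False using adj assms(2) d(3,4) eq by (auto simp: neg_flag_def)
      next
        assume r: "?r d = opp (?r d')"
        then have "fst d \<noteq> fst d'" using fst_opp_neq[OF rd(2)] by (metis fst_conv)
        moreover have "snd (opp (?r d)) \<noteq> snd (opp (?r d'))"
          using snd_opp_neq[OF rd(2)] opp_opp[OF rd(2)] r by (metis)
        then have "snd d \<noteq> snd d'" using opp_rh d(1,2) by (metis mem_Times_iff)
        ultimately show False using adj d(3,4) eq by (auto simp: neg_flag_def)
      qed
    qed
  qed
  ultimately show ?thesis using \<Phi>\<Psi> flags_poly by blast
qed

section \<open>Automorphisms induced by maps of vertices and faces\<close>

definition map_aut :: "(int \<Rightarrow> int) \<Rightarrow> (int \<Rightarrow> int) \<Rightarrow> bool" where
  "map_aut g h \<longleftrightarrow> (\<forall>v\<in>V. g v \<in> V) \<and> inj_on g V \<and> (\<forall>f\<in>F. h f \<in> F) \<and> inj_on h F \<and>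
     (\<forall>d \<in> V \<times> F. opp (map_prod g h d) = map_prod g h (opp d))"

text \<open>The outer \<open>edge\<close> renormalises the image dart, because \<open>g\<close> may
  send an even vertex to an odd one.\<close>

definition lift :: "(int \<Rightarrow> int) \<Rightarrow> (int \<Rightarrow> int) \<Rightarrow> nat \<Rightarrow> nat" where
  "lift g h x = (if x mod 3 = 0 then vcode (g (from_nat (x div 3)))
     else if x mod 3 = 1 then ecode (edge (map_prod g h (from_nat (x div 3))))
     else fcode (h (from_nat (x div 3))))"

lemma lift_code [simp]:
  "lift g h (vcode v) = vcode (g v)"
  "lift g h (ecode d) = ecode (edge (map_prod g h d))"
  "lift g h (fcode f) = fcode (h f)"
  by (simp_all add: lift_def)

lemma map_aut_in: "map_aut g h \<Longrightarrow> d \<in> V \<times> F \<Longrightarrow> map_prod g h d \<in> V \<times> F"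
  unfolding map_aut_def by auto

lemma map_aut_opp: "map_aut g h \<Longrightarrow> d \<in> V \<times> F \<Longrightarrow> opp (map_prod g h d) = map_prod g h (opp d)"
  unfolding map_aut_def by auto

lemma map_aut_inj:
  "map_aut g h \<Longrightarrow> d \<in> V \<times> F \<Longrightarrow> d' \<in> V \<times> F \<Longrightarrow> map_prod g h d = map_prod g h d' \<longleftrightarrow> d = d'"
  unfolding map_aut_def inj_on_def by auto

lemma edge_map_edge:
  assumes "map_aut g h" "d \<in> V \<times> F"
  shows "edge (map_prod g h (edge d)) = edge (map_prod g h d)"
  using edge_cases[of d] edge_opp[OF map_aut_in[OF assms]] map_aut_opp[OF assms] by auto

text \<open>\<open>rh v\<close> inverts the face component of \<open>opp\<close>, so commuting with
  \<open>opp\<close> carries over to the rotations; this is what makes the lift respect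
  \<open>neg_flag\<close>.\<close>

lemma map_aut_rh:
  assumes "map_aut g h" "v \<in> V" "f \<in> F"
  shows "rh (g v) (h f) = h (rh v f)"
proof -
  have d: "(v, rh v f) \<in> V \<times> F" using assms rh_in by auto
  have "snd (opp (g v, h (rh v f))) = h f"
    using map_aut_opp[OF assms(1) d] opp_rh assms by simp
  moreover have "g v \<in> V" "h (rh v f) \<in> F" using map_aut_in[OF assms(1) d] by auto
  ultimately show ?thesis using rh_opp by metis
qed

lemma automorphism_lift:
  assumes "map_aut g h"
  shows "automorphism poly (lift g h)"
proof -
  have g: "g v \<in> V" "g v = g w \<longleftrightarrow> v = w" if "v \<in> V" "w \<in> V" for v w
    using assms that by (auto simp: map_aut_def inj_on_def)
  have h: "h v \<in> F" "h v = h w \<longleftrightarrow> v = w" if "v \<in> F" "w \<in> F" for v w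
    using assms that by (auto simp: map_aut_def inj_on_def)
  let ?m = "map_prod g h"
  have m: "?m e \<in> V \<times> F" "opp (?m e) = ?m (opp e)" "edge (?m e) \<in> E" if "e \<in> E" for e
    using that E_subset assms map_aut_in map_aut_opp edge_in by metis+
  have e_inj: "edge (?m e) = edge (?m e') \<longleftrightarrow> e = e'" if "e \<in> E" "e' \<in> E" for e e'
  proof
    assume "edge (?m e) = edge (?m e')"
    then have "?m e = ?m e' \<or> ?m e = ?m (opp e')" using m that edge_eq_iff by metis
    then have "e = e' \<or> e = opp e'" using map_aut_inj[OF assms] that E_subset opp_in by metis
    then show "e = e'" using that E_subset edge_opp edge_of_E by metis
  qed simp
  have ve: "g v = fst (edge (?m e)) \<or> g v = fst (opp (edge (?m e))) \<longleftrightarrow> v = fst e \<or> v = fst (opp e)"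
    if "v \<in> V" "e \<in> E" for v e
  proof -
    have "fst e \<in> V" "fst (opp e) \<in> V" using that E_subset opp_in by (metis mem_Times_iff)+
    then show ?thesis using vertex_on_edge[OF m(1)[OF that(2)], of "g v"] m(2)[OF that(2)] g that by simp
  qed
  have fe: "h f = snd (edge (?m e)) \<or> h f = snd (opp (edge (?m e))) \<longleftrightarrow> f = snd e \<or> f = snd (opp e)"
    if "f \<in> F" "e \<in> E" for f e
  proof -
    have "snd e \<in> F" "snd (opp e) \<in> F" using that E_subset opp_in by (metis mem_Times_iff)+
    then show ?thesis using face_on_edge[OF m(1)[OF that(2)], of "h f"] m(2)[OF that(2)] h that by simp
  qed
  have "finite (elems poly)" using finite_V finite_F by (simp add: elems_poly E_def)
  moreover have "lift g h ` elems poly \<subseteq> elems poly"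
    using g(1) h(1) m(3) by (auto simp: elems_poly simp del: split_paired_Ex split_paired_All)
  moreover have "inj_on (lift g h) (elems poly)"
    unfolding inj_on_def elems_poly using g(2) h(2) e_inj
    by (auto simp del: split_paired_Ex split_paired_All)
  ultimately have "bij_betw (lift g h) (elems poly) (elems poly)"
    by (simp add: bij_betw_def endo_inj_surj)
  moreover have "rk poly (lift g h x) = rk poly x" if "x \<in> elems poly" for x
    using that by (auto simp: elems_poly simp del: split_paired_Ex split_paired_All)
  moreover have "incident poly (lift g h x) (lift g h y) \<longleftrightarrow> incident poly x y"
    if x: "x \<in> elems poly" and y: "y \<in> elems poly" for x y
  proof -
    have "(\<exists>v\<in>V. x = vcode v) \<or> (\<exists>e\<in>E. x = ecode e) \<or> (\<exists>f\<in>F. x = fcode f)"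
      "(\<exists>v\<in>V. y = vcode v) \<or> (\<exists>e\<in>E. y = ecode e) \<or> (\<exists>f\<in>F. y = fcode f)"
      using x y by (auto simp: elems_poly simp del: split_paired_Ex split_paired_All)
    then show ?thesis
      by (elim disjE bexE) (simp_all add: g h m e_inj ve fe)
  qed
  ultimately show ?thesis unfolding automorphism_def by blast
qed

lemma flag_image_lift:
  assumes "map_aut g h" "d \<in> V \<times> F"
  shows "flag_image (lift g h) (pos_flag d) = pos_flag (map_prod g h d)"
    and "flag_image (lift g h) (neg_flag d) = neg_flag (map_prod g h d)"
proof -
  show "flag_image (lift g h) (pos_flag d) = pos_flag (map_prod g h d)"
    using edge_map_edge[OF assms] by (simp add: flag_image_def pos_flag_def)
  have "(fst d, rh (fst d) (snd d)) \<in> V \<times> F" using assms rh_in by auto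
  from edge_map_edge[OF assms(1) this] show "flag_image (lift g h) (neg_flag d) = neg_flag (map_prod g h d)"
    using map_aut_rh[OF assms(1)] assms(2) by (auto simp: flag_image_def neg_flag_def)
qed

text \<open>Lifted dart symmetries keep each class and act transitively on it, while a single pair
  of flags that no automorphism matches rules out transitivity on all flags.\<close>

lemma chiral_poly:
  assumes trans: "\<And>d d'. d \<in> V \<times> F \<Longrightarrow> d' \<in> V \<times> F \<Longrightarrow> \<exists>g h. map_aut g h \<and> map_prod g h d = d'"
    and d0: "d0 \<in> V \<times> F"
    and irr: "\<And>\<gamma>. automorphism poly \<gamma> \<Longrightarrow> flag_image \<gamma> (pos_flag d0) \<noteq> neg_flag d0"
  shows "chiral poly"
proof -
  have pos: "transitive_on_flags poly (pos_flag ` (V \<times> F))"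
    unfolding transitive_on_flags_def
  proof (intro ballI, elim imageE)
    fix \<Phi> \<Psi> d d' assume d: "\<Phi> = pos_flag d" "\<Psi> = pos_flag d'" "d \<in> V \<times> F" "d' \<in> V \<times> F"
    then obtain g h where "map_aut g h" "map_prod g h d = d'" using trans by blast
    then show "\<exists>g. automorphism poly g \<and> flag_image g \<Phi> = \<Psi>"
      using automorphism_lift flag_image_lift(1) d by metis
  qed
  have neg: "transitive_on_flags poly (neg_flag ` (V \<times> F))"
    unfolding transitive_on_flags_def
  proof (intro ballI, elim imageE)
    fix \<Phi> \<Psi> d d' assume d: "\<Phi> = neg_flag d" "\<Psi> = neg_flag d'" "d \<in> V \<times> F" "d' \<in> V \<times> F"
    then obtain g h where "map_aut g h" "map_prod g h d = d'" using trans by blast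
    then show "\<exists>g. automorphism poly g \<and> flag_image g \<Phi> = \<Psi>"
      using automorphism_lift flag_image_lift(2) d by metis
  qed
  have "pos_flag d0 \<in> flags poly" "neg_flag d0 \<in> flags poly" using d0 flags_poly by auto
  then have not_trans: "\<not> transitive_on_flags poly (flags poly)"
    unfolding transitive_on_flags_def using irr by meson
  show ?thesis
    unfolding chiral_def
  proof (rule exI[of _ "pos_flag ` (V \<times> F)"], rule exI[of _ "neg_flag ` (V \<times> F)"], intro conjI)
    show "\<forall>i\<le>2. \<forall>\<Phi> \<Psi>. adjacent_flags poly i \<Phi> \<Psi> \<longrightarrow>
        \<Phi> \<in> pos_flag ` (V \<times> F) \<and> \<Psi> \<in> neg_flag ` (V \<times> F) \<or>
        \<Phi> \<in> neg_flag ` (V \<times> F) \<and> \<Psi> \<in> pos_flag ` (V \<times> F)"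
      using adjacent_pos_neg by blast
  qed (fact pos neg not_trans flags_poly[symmetric] pos_neg_disjoint)+
qed

section \<open>What an arbitrary automorphism does to vertices and faces\<close>

lemma automorphism_induces:
  assumes "automorphism poly \<gamma>"
  obtains g h where
    "\<And>v. v \<in> V \<Longrightarrow> g v \<in> V \<and> \<gamma> (vcode v) = vcode (g v)"
    "\<And>f. f \<in> F \<Longrightarrow> h f \<in> F \<and> \<gamma> (fcode f) = fcode (h f)"
    "\<And>e. e \<in> E \<Longrightarrow> \<exists>e'\<in>E. \<gamma> (ecode e) = ecode e'"
    "inj_on g V" "inj_on h F"
proof -
  have bij: "bij_betw \<gamma> (elems poly) (elems poly)" and rk: "\<forall>x\<in>elems poly. \<gamma> x mod 3 = x mod 3"
    using assms by (auto simp: automorphism_def)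
  have \<gamma>: "\<gamma> x \<in> elems poly" "\<gamma> x mod 3 = x mod 3" if "x \<in> elems poly" for x
    using bij rk that by (auto simp: bij_betw_def)
  have v: "\<exists>w\<in>V. \<gamma> (vcode v) = vcode w" if "v \<in> V" for v
    using \<gamma>[of "vcode v"] that by (auto simp: elems_poly)
  have f: "\<exists>w\<in>F. \<gamma> (fcode v) = fcode w" if "v \<in> F" for v
    using \<gamma>[of "fcode v"] that by (auto simp: elems_poly)
  have e: "\<exists>w\<in>E. \<gamma> (ecode v) = ecode w" if "v \<in> E" for v
    using \<gamma>[of "ecode v"] that by (auto simp: elems_poly)
  obtain g where g: "\<And>v. v \<in> V \<Longrightarrow> g v \<in> V \<and> \<gamma> (vcode v) = vcode (g v)" using v by metis
  obtain h where h: "\<And>f. f \<in> F \<Longrightarrow> h f \<in> F \<and> \<gamma> (fcode f) = fcode (h f)" using f by metis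
  have inj: "inj_on \<gamma> (elems poly)" using bij by (simp add: bij_betw_def)
  have "v = w" if "v \<in> V" "w \<in> V" "g v = g w" for v w
    using inj_onD[OF inj, of "vcode v" "vcode w"] that g by (simp add: elems_poly)
  moreover have "v = w" if "v \<in> F" "w \<in> F" "h v = h w" for v w
    using inj_onD[OF inj, of "fcode v" "fcode w"] that h by (simp add: elems_poly)
  ultimately have "inj_on g V" "inj_on h F" by (auto simp: inj_on_def)
  then show thesis using that g h e by blast
qed

text \<open>Incidence preservation is turned into equations on vertices and faces. The reversal
  fixes \<open>v0\<close> and \<open>f0\<close> and exchanges the edge for the other one there, so
  the far ends and far sides of these two edges must match. At a general vertex only adjacency in
  the rotation survives; the direction of turning stays open.\<close>

lemma reversing_automorphism:
  assumes \<gamma>: "automorphism poly \<gamma>" and d0: "(v0, f0) \<in> V \<times> F"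
    and rev: "flag_image \<gamma> (pos_flag (v0, f0)) = neg_flag (v0, f0)"
  obtains g h where "h ` F \<subseteq> F" "inj_on h F" "h f0 = f0" "g v0 = v0"
    "g (fst (opp (v0, f0))) = fst (opp (v0, rh v0 f0))"
    "h (snd (opp (v0, f0))) = rh v0 f0"
    "\<And>v f. v \<in> V \<Longrightarrow> f \<in> F \<Longrightarrow> h (rh v f) = rh (g v) (h f) \<or> rh (g v) (h (rh v f)) = h f"
proof -
  obtain g h where
    g: "\<And>v. v \<in> V \<Longrightarrow> g v \<in> V \<and> \<gamma> (vcode v) = vcode (g v)" and
    h: "\<And>f. f \<in> F \<Longrightarrow> h f \<in> F \<and> \<gamma> (fcode f) = fcode (h f)" and
    e: "\<And>e. e \<in> E \<Longrightarrow> \<exists>e'\<in>E. \<gamma> (ecode e) = ecode e'" and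
    inj: "inj_on g V" "inj_on h F"
    by (rule automorphism_induces[OF \<gamma>]) blast
  have inc: "incident poly (\<gamma> x) (\<gamma> y) \<longleftrightarrow> incident poly x y" if "x \<in> elems poly" "y \<in> elems poly" for x y
    using \<gamma> that by (auto simp: automorphism_def)
  have vin: "vcode v \<in> elems poly" if "v \<in> V" for v using that by (auto simp: elems_poly)
  have fin: "fcode v \<in> elems poly" if "v \<in> F" for v using that by (auto simp: elems_poly)
  have ein: "ecode v \<in> elems poly" if "v \<in> E" for v using that by (auto simp: elems_poly)
  have v0: "v0 \<in> V" and f0: "f0 \<in> F" using d0 by auto
  have r0: "(v0, rh v0 f0) \<in> V \<times> F" using v0 f0 rh_in by auto
  have flag0: "g v0 = v0" "h f0 = f0" "\<gamma> (ecode (edge (v0, f0))) = ecode (edge (v0, rh v0 f0))"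
    using rev v0 f0 g h by (auto simp: flag_image_def pos_flag_def neg_flag_def)
  have o: "fst (opp (v0, f0)) \<in> V" "snd (opp (v0, f0)) \<in> F" using opp_in[OF d0] by auto
  have "incident poly (vcode (fst (opp (v0, f0)))) (ecode (edge (v0, f0)))"
    using vertex_on_edge[OF d0] edge_in[OF d0] by auto
  then have "incident poly (vcode (g (fst (opp (v0, f0))))) (ecode (edge (v0, rh v0 f0)))"
    using inc[OF vin[OF o(1)] ein[OF edge_in[OF d0]]] g[OF o(1)] flag0(3) by simp
  then have "g (fst (opp (v0, f0))) = v0 \<or> g (fst (opp (v0, f0))) = fst (opp (v0, rh v0 f0))"
    using vertex_on_edge[OF r0] by simp
  moreover have "g (fst (opp (v0, f0))) \<noteq> g v0"
    using fst_opp_neq[OF d0] o(1) v0 inj(1) by (auto simp: inj_on_def)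
  ultimately have gopp: "g (fst (opp (v0, f0))) = fst (opp (v0, rh v0 f0))" using flag0 by simp
  have "incident poly (ecode (edge (v0, f0))) (fcode (snd (opp (v0, f0))))"
    using face_on_edge[OF d0] edge_in[OF d0] by auto
  then have "incident poly (ecode (edge (v0, rh v0 f0))) (fcode (h (snd (opp (v0, f0)))))"
    using inc[OF ein[OF edge_in[OF d0]] fin[OF o(2)]] h[OF o(2)] flag0(3) by simp
  then have "h (snd (opp (v0, f0))) = rh v0 f0 \<or> h (snd (opp (v0, f0))) = f0"
    using face_on_edge[OF r0] opp_rh[OF v0 f0] by simp
  moreover have "h (snd (opp (v0, f0))) \<noteq> h f0"
    using snd_opp_neq[OF d0] o(2) f0 inj(2) by (auto simp: inj_on_def)
  ultimately have hopp: "h (snd (opp (v0, f0))) = rh v0 f0" using flag0 by simp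
  have walk: "h (rh v f) = rh (g v) (h f) \<or> rh (g v) (h (rh v f)) = h f" if vf: "v \<in> V" "f \<in> F" for v f
  proof -
    \<comment> \<open>This edge separates \<open>f\<close> from \<open>rh v f\<close>. Its image is
      an edge at \<open>g v\<close>, whose two sides are consecutive around \<open>g v\<close> in
      one order or the other.\<close>
    let ?e = "edge (v, rh v f)"
    have r: "(v, rh v f) \<in> V \<times> F" "rh v f \<in> F" using vf rh_in by auto
    have E: "?e \<in> E" using edge_in r by auto
    obtain e' where e': "e' \<in> E" "\<gamma> (ecode ?e) = ecode e'" using e[OF E] by auto
    have gv: "g v \<in> V" "h f \<in> F" "h (rh v f) \<in> F" using g h vf r by auto
    have "incident poly (vcode v) (ecode ?e)" "incident poly (ecode ?e) (fcode f)"
      "incident poly (ecode ?e) (fcode (rh v f))"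
      using vertex_on_edge[OF r(1)] face_on_edge[OF r(1)] opp_rh[OF vf] E by auto
    then have "incident poly (vcode (g v)) (ecode e')" "incident poly (ecode e') (fcode (h f))"
      "incident poly (ecode e') (fcode (h (rh v f)))"
      using inc[OF vin[OF vf(1)] ein[OF E]] inc[OF ein[OF E] fin[OF vf(2)]]
        inc[OF ein[OF E] fin[OF r(2)]] g[OF vf(1)] h[OF vf(2)] h[OF r(2)] e' by simp_all
    then have "e' \<in> edge ` ({g v} \<times> F)"
      "h f = snd e' \<or> h f = snd (opp e')" "h (rh v f) = snd e' \<or> h (rh v f) = snd (opp e')"
      using edges_at_vertex[OF gv(1)] e'(1) by auto
    then obtain k where k: "k \<in> F" "e' = edge (g v, k)" by auto
    have kd: "(g v, k) \<in> V \<times> F" using k gv by auto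
    have "h f = k \<or> h f = snd (opp (g v, k))" "h (rh v f) = k \<or> h (rh v f) = snd (opp (g v, k))"
      using \<open>h f = snd e' \<or> h f = snd (opp e')\<close> \<open>h (rh v f) = snd e' \<or> h (rh v f) = snd (opp e')\<close>
        face_on_edge[OF kd] k(2) by auto
    moreover have "h (rh v f) \<noteq> h f" using rh_neq[OF vf] r(2) vf(2) inj(2) by (auto simp: inj_on_def)
    ultimately show ?thesis using rh_opp[OF gv(1) k(1)] by auto
  qed
  show thesis
  proof (rule that[of h g])
    show "h ` F \<subseteq> F" using h by auto
  qed (use inj flag0 gopp hopp walk in auto)
qed

end

section \<open>Maps from reciprocal skew morphisms\<close>

lemma mod_cong: "[x mod m = x] (mod m)" for x m :: int
  by (simp add: cong_def)

lemma cong_add1: "[a = b] (mod m) \<Longrightarrow> [a + 1 = b + 1] (mod m)"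
  and cong_sub1: "[a = b] (mod m) \<Longrightarrow> [a - 1 = b - 1] (mod m)" for a b m :: int
  by (simp_all add: cong_iff_dvd_diff)

lemma inj_on_add_mod: "m > 0 \<Longrightarrow> inj_on (\<lambda>v. (v + 1) mod m) {0..<m}" for m :: int
  by (rule inj_onI) (metis add.commute add_left_cancel cong_add_rcancel cong_def atLeastLessThan_iff mod_pos_pos_trivial)

text \<open>\<open>Pi f\<close> and \<open>K v\<close> stand for \<open>\<pi>\<^sup>f\<close> and \<open>\<kappa>\<^sup>v\<close>. The assumptions \<open>Pi_skew\<close> and \<open>K_skew\<close> say that
  \<open>x y\<^sup>f \<in> y\<^bsup>\<kappa> f\<^esup>\<langle>x\<rangle>\<close> and \<open>y x\<^sup>v \<in> x\<^bsup>\<pi> v\<^esup>\<langle>y\<rangle>\<close>, so that \<open>\<langle>x\<rangle>\<langle>y\<rangle>\<close> is a group.\<close>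

locale reciprocal_actions =
  fixes p q :: int and Pi K :: "int \<Rightarrow> int \<Rightarrow> int"
  assumes p_gt: "p > 2" and q_gt: "q > 2" and even_p: "even p"
    and Pi_cong: "[f = f'] (mod q) \<Longrightarrow> [a = b] (mod p) \<Longrightarrow> [Pi f a = Pi f' b] (mod p)"
    and Pi_0: "[Pi 0 a = a] (mod p)"
    and Pi_add: "[Pi (f + f') a = Pi f (Pi f' a)] (mod p)"
    and Pi_fix: "[Pi f 0 = 0] (mod p)"
    and Pi_1: "[Pi 1 1 = -1] (mod p)"
    and Pi_parity: "even (Pi f a) \<longleftrightarrow> even a"
    and Pi_skew: "\<exists>e. \<forall>a. [Pi f a + 1 = Pi (K 1 f) (a + e)] (mod p)"
    and K_cong: "[v = w] (mod p) \<Longrightarrow> [f = f'] (mod q) \<Longrightarrow> [K v f = K w f'] (mod q)"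
    and K_0: "[K 0 f = f] (mod q)"
    and K_add: "[K (v + w) f = K v (K w f)] (mod q)"
    and K_fix: "[K v 0 = 0] (mod q)"
    and K_1: "[K 1 1 = -1] (mod q)"
    and K_skew: "\<exists>e. \<forall>f. [K v f + 1 = K (Pi 1 v) (f + e)] (mod q)"
    and K_chiral: "\<not> [K 1 (- K 1 2) = -2] (mod q)"
begin

abbreviation "V \<equiv> {0..<p}"
abbreviation "F \<equiv> {0..<q}"

text \<open>With \<open>x\<close> and \<open>y\<close> as rotations about face 0 and vertex 0,
  \<open>sg f\<close> is the action of \<open>y^f x y^(-f)\<close> on vertices and
  \<open>rh v\<close> that of \<open>x^v y x^(-v)\<close> on faces; \<open>ri v\<close> inverts
  \<open>rh v\<close>. So \<open>opp\<close> leads to the next vertex around \<open>f\<close> and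
  the previous face around \<open>v\<close>.\<close>

definition sg :: "int \<Rightarrow> int \<Rightarrow> int" where "sg f v = Pi f (Pi (- f) v + 1) mod p"
definition rh :: "int \<Rightarrow> int \<Rightarrow> int" where "rh v f = K v (K (- v) f + 1) mod q"
definition ri :: "int \<Rightarrow> int \<Rightarrow> int" where "ri v f = K v (K (- v) f - 1) mod q"
definition opp :: "int \<times> int \<Rightarrow> int \<times> int" where "opp d = (sg (snd d) (fst d), ri (fst d) (snd d))"

section \<open>Rotations about faces and vertices as conjugated translations\<close>

lemma p_pos: "p > 0" and q_pos: "q > 0"
  using p_gt q_gt by auto

lemma Pi_inv: "[Pi f (Pi (- f) a) = a] (mod p)" "[Pi (- f) (Pi f a) = a] (mod p)"
  using Pi_add[of f "- f" a] Pi_add[of "- f" f a] Pi_0[of a] by (metis cong_sym cong_trans add.right_inverse add.left_inverse)+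

lemma K_inv: "[K v (K (- v) f) = f] (mod q)" "[K (- v) (K v f) = f] (mod q)"
  using K_add[of v "- v" f] K_add[of "- v" v f] K_0[of f] by (metis cong_sym cong_trans add.right_inverse add.left_inverse)+

lemma Pi_cong': "[a = b] (mod p) \<Longrightarrow> [Pi f a = Pi f b] (mod p)"
  using Pi_cong by auto

lemma K_cong': "[f = f'] (mod q) \<Longrightarrow> [K v f = K v f'] (mod q)"
  using K_cong by auto

lemma sg_cong: "[sg f v = Pi f (Pi (- f) v + 1)] (mod p)"
  and rh_cong: "[rh v f = K v (K (- v) f + 1)] (mod q)"
  and ri_cong: "[ri v f = K v (K (- v) f - 1)] (mod q)"
  unfolding sg_def rh_def ri_def by (rule mod_cong)+

lemma sg_eqI:
  assumes "[f = f'] (mod q)" "[v = v'] (mod p)"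
  shows "sg f v = sg f' v'"
proof -
  have "[- f = - f'] (mod q)" using assms(1) by (simp add: cong_minus_minus_iff)
  then have "[Pi (- f) v + 1 = Pi (- f') v' + 1] (mod p)" using assms Pi_cong cong_add cong_refl by blast
  then show ?thesis unfolding sg_def using Pi_cong[OF assms(1)] by (simp add: cong_def)
qed

lemma ri_eqI:
  assumes "[f = f'] (mod q)" "[v = v'] (mod p)"
  shows "ri v f = ri v' f'"
proof -
  have "[- v = - v'] (mod p)" using assms(2) by (simp add: cong_minus_minus_iff)
  then have "[K (- v) f - 1 = K (- v') f' - 1] (mod q)" using assms K_cong cong_diff cong_refl by blast
  then show ?thesis unfolding ri_def using K_cong[OF assms(2)] by (simp add: cong_def)
qed

lemma K_shift: "[K (- v) (rh v f) = K (- v) f + 1] (mod q)" "[K (- v) (ri v f) = K (- v) f - 1] (mod q)"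
  using K_cong'[OF rh_cong[of v f], of "- v"] K_cong'[OF ri_cong[of v f], of "- v"] K_inv(2) cong_trans by blast+

lemma ri_rh: "[ri v (rh v f) = f] (mod q)"
proof -
  have "[K (- v) (rh v f) - 1 = K (- v) f] (mod q)"
    using cong_diff[OF K_shift(1) cong_refl[of 1 q], of v f] by simp
  from cong_trans[OF ri_cong cong_trans[OF K_cong'[OF this] K_inv(1)]] show ?thesis .
qed

lemma rh_ri: "[rh v (ri v f) = f] (mod q)"
proof -
  have "[K (- v) (ri v f) + 1 = K (- v) f] (mod q)"
    using cong_add[OF K_shift(2) cong_refl[of 1 q], of v f] by simp
  from cong_trans[OF rh_cong cong_trans[OF K_cong'[OF this] K_inv(1)]] show ?thesis .
qed

lemma sg_pow: "[(sg f ^^ n) v = Pi f (Pi (- f) v + int n)] (mod p)"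
proof (induction n)
  case 0 then show ?case using cong_sym[OF Pi_inv(1)] by simp
next
  case (Suc n)
  have "[Pi (- f) ((sg f ^^ n) v) = Pi (- f) v + int n] (mod p)"
    using Pi_cong'[OF Suc, of "- f"] Pi_inv(2) cong_trans by blast
  then have "[Pi (- f) ((sg f ^^ n) v) + 1 = Pi (- f) v + int n + 1] (mod p)"
    by (intro cong_add) auto
  then have "[Pi f (Pi (- f) ((sg f ^^ n) v) + 1) = Pi f (Pi (- f) v + int (Suc n))] (mod p)"
    using Pi_cong'[of _ _ f] by (simp add: add_ac)
  then show ?case using sg_cong[of f "(sg f ^^ n) v"] cong_trans by auto
qed

lemma rh_pow: "[(rh v ^^ n) f = K v (K (- v) f + int n)] (mod q)"
proof (induction n)
  case 0 then show ?case using cong_sym[OF K_inv(1)] by simp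
next
  case (Suc n)
  have "[K (- v) ((rh v ^^ n) f) = K (- v) f + int n] (mod q)"
    using K_cong'[OF Suc, of "- v"] K_inv(2) cong_trans by blast
  then have "[K (- v) ((rh v ^^ n) f) + 1 = K (- v) f + int n + 1] (mod q)"
    by (intro cong_add) auto
  then have "[K v (K (- v) ((rh v ^^ n) f) + 1) = K v (K (- v) f + int (Suc n))] (mod q)"
    using K_cong'[of _ _ v] by (simp add: add_ac)
  then show ?case using rh_cong[of v "(rh v ^^ n) f"] cong_trans by auto
qed

lemma sg_in [simp]: "sg f v \<in> V" and rh_in [simp]: "rh v f \<in> F" and ri_in [simp]: "ri v f \<in> F"
  using p_pos q_pos by (auto simp: sg_def rh_def ri_def)

lemma V_cong_eq: "v \<in> V \<Longrightarrow> w \<in> V \<Longrightarrow> [v = w] (mod p) \<Longrightarrow> v = w"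
  and F_cong_eq: "f \<in> F \<Longrightarrow> g \<in> F \<Longrightarrow> [f = g] (mod q) \<Longrightarrow> f = g"
  by (auto simp: cong_def)

lemma sg_transitive:
  assumes "v \<in> V" "w \<in> V"
  shows "\<exists>n. w = (sg f ^^ n) v"
proof -
  \<comment> \<open>The translation distance after conjugating by \<open>Pi (- f)\<close>.\<close>
  define n where "n = nat ((Pi (- f) w - Pi (- f) v) mod p)"
  have "[Pi (- f) v + int n = Pi (- f) w] (mod p)"
    unfolding n_def cong_def using p_pos by (simp add: mod_simps)
  then have "[Pi f (Pi (- f) v + int n) = w] (mod p)" using Pi_cong' Pi_inv(1) cong_trans by blast
  then have "[(sg f ^^ n) v = w] (mod p)" using sg_pow cong_trans by blast
  moreover have "(sg f ^^ n) v \<in> V" using assms(1) by (cases n) (simp_all del: atLeastLessThan_iff)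
  ultimately show ?thesis using V_cong_eq assms by metis
qed

lemma rh_transitive:
  assumes "f \<in> F" "g \<in> F"
  shows "\<exists>n. g = (rh v ^^ n) f"
proof -
  define n where "n = nat ((K (- v) g - K (- v) f) mod q)"
  have "[K (- v) f + int n = K (- v) g] (mod q)"
    unfolding n_def cong_def using q_pos by (simp add: mod_simps)
  then have "[K v (K (- v) f + int n) = g] (mod q)" using K_cong' K_inv(1) cong_trans by blast
  then have "[(rh v ^^ n) f = g] (mod q)" using rh_pow cong_trans by blast
  moreover have "(rh v ^^ n) f \<in> F" using assms(1) by (cases n) (simp_all del: atLeastLessThan_iff)
  ultimately show ?thesis using F_cong_eq assms by metis
qed

lemma rh_neq: "rh v f \<noteq> f"
proof
  assume "rh v f = f"
  then have "[K (- v) f = K (- v) f + 1] (mod q)" using K_shift(1)[of v f] by simp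
  then have "[0 = 1] (mod q)" by (simp add: cong_iff_dvd_diff)
  then show False using q_gt by (simp add: cong_def)
qed

lemma even_mod_p: "even (x mod p) \<longleftrightarrow> even x"
  using even_p by (simp add: dvd_mod_iff)

text \<open>\<open>Pi\<close> keeps parity, the translation by 1 flips it, and \<open>p\<close> is
  even. So every edge joins an even vertex to an odd one, as the choice of edge representatives
  requires.\<close>

lemma sg_parity: "even (sg f v) \<longleftrightarrow> odd v"
  by (simp add: sg_def even_mod_p Pi_parity)

text \<open>The condition \<open>map_aut\<close> of \<open>flat_map\<close>, stated ahead of the
  interpretation of that locale: the symmetries are used to prove \<open>opp_opp\<close>, which the
  interpretation requires.\<close>

definition commuting :: "(int \<Rightarrow> int) \<Rightarrow> (int \<Rightarrow> int) \<Rightarrow> bool" where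
  "commuting g h \<longleftrightarrow> (\<forall>v\<in>V. g v \<in> V) \<and> inj_on g V \<and> (\<forall>f\<in>F. h f \<in> F) \<and> inj_on h F \<and>
     (\<forall>d \<in> V \<times> F. opp (map_prod g h d) = map_prod g h (opp d))"

lemma opp_in: "opp d \<in> V \<times> F"
  unfolding opp_def by (metis mem_Sigma_iff sg_in ri_in)

lemma commuting_id: "commuting id id"
  unfolding commuting_def by (simp add: map_prod.id)

lemma commuting_comp:
  assumes "commuting g h" "commuting g' h'"
  shows "commuting (g' \<circ> g) (h' \<circ> h)"
proof -
  have c: "\<forall>v\<in>V. g v \<in> V" "\<forall>f\<in>F. h f \<in> F" "\<forall>v\<in>V. g' v \<in> V" "\<forall>f\<in>F. h' f \<in> F"
      "\<forall>d \<in> V \<times> F. opp (map_prod g h d) = map_prod g h (opp d)"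
      "\<forall>d \<in> V \<times> F. opp (map_prod g' h' d) = map_prod g' h' (opp d)"
    and inj: "inj_on g V" "inj_on h F" "inj_on g' V" "inj_on h' F"
    using assms unfolding commuting_def by simp_all
  have sub: "g ` V \<subseteq> V" "h ` F \<subseteq> F"
    using c(1,2) unfolding image_subset_iff .
  have "inj_on (g' \<circ> g) V" "inj_on (h' \<circ> h) F"
    using comp_inj_on[OF inj(1) inj_on_subset[OF inj(3) sub(1)]]
      comp_inj_on[OF inj(2) inj_on_subset[OF inj(4) sub(2)]] .
  moreover have "opp (map_prod (g' \<circ> g) (h' \<circ> h) d) = map_prod (g' \<circ> g) (h' \<circ> h) (opp d)"
    if "d \<in> V \<times> F" for d
  proof -
    have "fst d \<in> V" "snd d \<in> F" using that by auto
    then have "map_prod g h d \<in> V \<times> F" using c by (simp add: mem_Times_iff del: atLeastLessThan_iff)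
    from bspec[OF c(6) this] bspec[OF c(5) that]
    show ?thesis by (simp add: map_prod.comp[symmetric])
  qed
  moreover have "\<forall>v\<in>V. (g' \<circ> g) v \<in> V" "\<forall>f\<in>F. (h' \<circ> h) f \<in> F"
    using c by (simp_all del: atLeastLessThan_iff)
  ultimately show ?thesis unfolding commuting_def by blast
qed

text \<open>By \<open>Pi_skew\<close>, on vertices \<open>x y^f\<close> is \<open>y^(K 1 f)\<close>
  after a translation by \<open>e\<close>. Translations commute, so \<open>x\<close> conjugates the
  rotation about face \<open>f\<close> into the one about face \<open>K 1 f\<close>.\<close>

lemma sg_X: "[sg (K 1 f) (v + 1) = sg f v + 1] (mod p)"
proof -
  define u where "u = Pi (- f) v"
  have v: "[Pi f u = v] (mod p)" unfolding u_def by (rule Pi_inv)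
  obtain e where e: "\<And>a. [Pi f a + 1 = Pi (K 1 f) (a + e)] (mod p)" using Pi_skew by blast
  have "[v + 1 = Pi (K 1 f) (u + e)] (mod p)"
    using e[of u] cong_add[OF v cong_refl[of 1 p]] cong_sym cong_trans by blast
  then have "[Pi (- K 1 f) (v + 1) = u + e] (mod p)"
    using Pi_cong'[of _ _ "- K 1 f"] Pi_inv(2) cong_trans by blast
  then have "[Pi (- K 1 f) (v + 1) + 1 = (u + 1) + e] (mod p)"
    using cong_add1 by (fastforce simp: algebra_simps)
  then have "[sg (K 1 f) (v + 1) = Pi (K 1 f) ((u + 1) + e)] (mod p)"
    using sg_cong Pi_cong' cong_trans by blast
  also have "[Pi (K 1 f) ((u + 1) + e) = Pi f (u + 1) + 1] (mod p)"
    using e[of "u + 1"] cong_sym by blast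
  also have "[Pi f (u + 1) + 1 = sg f v + 1] (mod p)"
    using cong_add[OF cong_sym[OF sg_cong[of f v]] cong_refl[of 1 p]] by (simp add: u_def)
  finally show ?thesis .
qed

text \<open>Here the exponent law \<open>K_add\<close> does the work, because \<open>x\<close> times
  \<open>x^v\<close> is \<open>x^(v + 1)\<close>.\<close>

lemma ri_X: "[ri (v + 1) (K 1 f) = K 1 (ri v f)] (mod q)"
proof -
  have "[K (- (v + 1)) (K 1 f) = K (- v) f] (mod q)"
    using K_add[of "- (v + 1)" 1 f] cong_sym by simp
  then have "[ri (v + 1) (K 1 f) = K (v + 1) (K (- v) f - 1)] (mod q)"
    using cong_trans[OF ri_cong K_cong'[OF cong_sub1]] by blast
  then have "[ri (v + 1) (K 1 f) = K (1 + v) (K (- v) f - 1)] (mod q)" by (simp only: add.commute)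
  also have "[K (1 + v) (K (- v) f - 1) = K 1 (K v (K (- v) f - 1))] (mod q)" by (rule K_add)
  also have "[K 1 (K v (K (- v) f - 1)) = K 1 (ri v f)] (mod q)"
    using K_cong'[OF cong_sym[OF ri_cong]] .
  finally show ?thesis .
qed

lemma sg_Y: "[sg (f + 1) (Pi 1 v) = Pi 1 (sg f v)] (mod p)"
proof -
  have "[Pi (- (f + 1)) (Pi 1 v) = Pi (- f) v] (mod p)"
    using Pi_add[of "- (f + 1)" 1 v] cong_sym by simp
  then have "[sg (f + 1) (Pi 1 v) = Pi (f + 1) (Pi (- f) v + 1)] (mod p)"
    using cong_trans[OF sg_cong Pi_cong'[OF cong_add1]] by blast
  then have "[sg (f + 1) (Pi 1 v) = Pi (1 + f) (Pi (- f) v + 1)] (mod p)" by (simp only: add.commute)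
  also have "[Pi (1 + f) (Pi (- f) v + 1) = Pi 1 (Pi f (Pi (- f) v + 1))] (mod p)" by (rule Pi_add)
  also have "[Pi 1 (Pi f (Pi (- f) v + 1)) = Pi 1 (sg f v)] (mod p)"
    using Pi_cong'[OF cong_sym[OF sg_cong]] .
  finally show ?thesis .
qed

text \<open>The counterpart of \<open>sg_X\<close>, with \<open>K_skew\<close> for
  \<open>Pi_skew\<close> and the translation by -1.\<close>

lemma ri_Y: "[ri (Pi 1 v) (f + 1) = ri v f + 1] (mod q)"
proof -
  define u where "u = K (- v) f"
  have f: "[K v u = f] (mod q)" unfolding u_def by (rule K_inv)
  obtain e where e: "\<And>a. [K v a + 1 = K (Pi 1 v) (a + e)] (mod q)" using K_skew by blast
  have "[f + 1 = K (Pi 1 v) (u + e)] (mod q)"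
    using e[of u] cong_add[OF f cong_refl[of 1 q]] cong_sym cong_trans by blast
  then have "[K (- Pi 1 v) (f + 1) = u + e] (mod q)"
    using K_cong'[of _ _ "- Pi 1 v"] K_inv(2) cong_trans by blast
  then have "[K (- Pi 1 v) (f + 1) - 1 = (u - 1) + e] (mod q)"
    using cong_sub1 by (fastforce simp: algebra_simps)
  then have "[ri (Pi 1 v) (f + 1) = K (Pi 1 v) ((u - 1) + e)] (mod q)"
    using ri_cong K_cong' cong_trans by blast
  also have "[K (Pi 1 v) ((u - 1) + e) = K v (u - 1) + 1] (mod q)"
    using e[of "u - 1"] cong_sym by blast
  also have "[K v (u - 1) + 1 = ri v f + 1] (mod q)"
    using cong_add[OF cong_sym[OF ri_cong[of v f]] cong_refl[of 1 q]] by (simp add: u_def)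
  finally show ?thesis .
qed

lemma inj_on_K: "inj_on (\<lambda>f. K v f mod q) F"
proof (rule inj_onI)
  fix f g assume fg: "f \<in> F" "g \<in> F" "K v f mod q = K v g mod q"
  then have "[K v f = K v g] (mod q)" by (simp add: cong_def)
  then have "[f = g] (mod q)" using K_cong'[of _ _ "- v"] K_inv(2) cong_sym cong_trans by meson
  then show "f = g" using F_cong_eq fg by blast
qed

lemma inj_on_Pi: "inj_on (\<lambda>v. Pi f v mod p) V"
proof (rule inj_onI)
  fix v w assume vw: "v \<in> V" "w \<in> V" "Pi f v mod p = Pi f w mod p"
  then have "[Pi f v = Pi f w] (mod p)" by (simp add: cong_def)
  then have "[v = w] (mod p)" using Pi_cong'[of _ _ "- f"] Pi_inv(2) cong_sym cong_trans by meson
  then show "v = w" using V_cong_eq vw by blast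
qed

section \<open>Transitivity on darts through powers of \<open>x\<close> and \<open>y\<close>\<close>

lemma commuting_X: "commuting (\<lambda>v. (v + 1) mod p) (\<lambda>f. K 1 f mod q)"
proof -
  have "sg (K 1 f mod q) ((v + 1) mod p) = (sg f v + 1) mod p" for v f
    using sg_eqI[OF mod_cong mod_cong, of "K 1 f" "v + 1"] sg_X[of f v] sg_in[of "K 1 f" "v + 1"]
    by (auto simp: cong_def)
  moreover have "ri ((v + 1) mod p) (K 1 f mod q) = K 1 (ri v f) mod q" for v f
    using ri_eqI[OF mod_cong mod_cong, of "v + 1" "K 1 f"] ri_X[of v f] ri_in[of "v + 1" "K 1 f"]
    by (auto simp: cong_def)
  ultimately show ?thesis
    unfolding commuting_def using p_pos q_pos inj_on_add_mod inj_on_K by (auto simp: opp_def)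
qed

lemma commuting_Y: "commuting (\<lambda>v. Pi 1 v mod p) (\<lambda>f. (f + 1) mod q)"
proof -
  have "sg ((f + 1) mod q) (Pi 1 v mod p) = Pi 1 (sg f v) mod p" for v f
    using sg_eqI[OF mod_cong mod_cong, of "f + 1" "Pi 1 v"] sg_Y[of f v] sg_in[of "f + 1" "Pi 1 v"]
    by (auto simp: cong_def)
  moreover have "ri (Pi 1 v mod p) ((f + 1) mod q) = (ri v f + 1) mod q" for v f
    using ri_eqI[OF mod_cong mod_cong, of "Pi 1 v" "f + 1"] ri_Y[of v f] ri_in[of "Pi 1 v" "f + 1"]
    by (auto simp: cong_def)
  ultimately show ?thesis
    unfolding commuting_def using p_pos q_pos inj_on_add_mod inj_on_Pi by (auto simp: opp_def)
qed

lemma commuting_X_pow: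
  "\<exists>g h. commuting g h \<and> (\<forall>v\<in>V. g v = (v + int n) mod p) \<and> (\<forall>f\<in>F. h f = K (int n) f mod q)"
proof (induction n)
  case 0
  have "K 0 f mod q = f" if "f \<in> F" for f using K_0[of f] that by (simp add: cong_def)
  then show ?case using commuting_id[unfolded id_def] by (intro exI[of _ "\<lambda>x. x"]) auto
next
  case (Suc n)
  then obtain g h where gh: "commuting g h" "\<forall>v\<in>V. g v = (v + int n) mod p" "\<forall>f\<in>F. h f = K (int n) f mod q" by auto
  have "K 1 (K (int n) f mod q) mod q = K (int (Suc n)) f mod q" for f
    using K_cong'[OF mod_cong, of 1 "K (int n) f"] K_add[of 1 "int n" f] by (simp add: cong_def add_ac)
  then show ?case
    using commuting_comp[OF gh(1) commuting_X] gh(2,3)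
    by (intro exI conjI) (auto simp: mod_simps add_ac)
qed

lemma commuting_Y_pow:
  "\<exists>g h. commuting g h \<and> (\<forall>v\<in>V. g v = Pi (int n) v mod p) \<and> (\<forall>f\<in>F. h f = (f + int n) mod q)"
proof (induction n)
  case 0
  have "Pi 0 f mod p = f" if "f \<in> V" for f using Pi_0[of f] that by (simp add: cong_def)
  then show ?case using commuting_id[unfolded id_def] by (intro exI[of _ "\<lambda>x. x"]) auto
next
  case (Suc n)
  then obtain g h where gh: "commuting g h" "\<forall>v\<in>V. g v = Pi (int n) v mod p" "\<forall>f\<in>F. h f = (f + int n) mod q" by auto
  have "Pi 1 (Pi (int n) f mod p) mod p = Pi (int (Suc n)) f mod p" for f
    using Pi_cong'[OF mod_cong, of 1 "Pi (int n) f"] Pi_add[of 1 "int n" f] by (simp add: cong_def add_ac)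
  then show ?case
    using commuting_comp[OF gh(1) commuting_Y] gh(2,3)
    by (intro exI conjI) (auto simp: mod_simps add_ac)
qed

lemma zero_in: "0 \<in> V" "0 \<in> F" using p_pos q_pos by auto

lemma commuting_from_zero:
  assumes "d \<in> V \<times> F"
  shows "\<exists>g h. commuting g h \<and> map_prod g h (0, 0) = d"
proof -
  obtain v f where d: "d = (v, f)" "v \<in> V" "f \<in> F" using assms by auto
  \<comment> \<open>The symmetry is \<open>x^v y^b\<close>: first \<open>y^b\<close> fixes vertex 0
    and moves face 0 to \<open>b\<close>, then \<open>x^v\<close> moves vertex 0 to \<open>v\<close>
    and face \<open>b\<close> to \<open>K v b\<close>, which has to be \<open>f\<close>.\<close>
  define b where "b = K (- v) f mod q"
  have b: "b \<in> F" using q_pos by (simp add: b_def)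
  obtain g h where gh: "commuting g h" "\<forall>v\<in>V. g v = Pi (int (nat b)) v mod p" "\<forall>f\<in>F. h f = (f + int (nat b)) mod q"
    using commuting_Y_pow by blast
  obtain g' h' where gh': "commuting g' h'" "\<forall>w\<in>V. g' w = (w + int (nat v)) mod p" "\<forall>f\<in>F. h' f = K (int (nat v)) f mod q"
    using commuting_X_pow by blast
  have "g 0 = 0" "h 0 = b" using gh zero_in Pi_fix b by (auto simp: cong_def)
  moreover have "g' 0 = v" using gh' zero_in d by auto
  moreover have "K v b mod q = f"
    using K_cong'[OF mod_cong, of v "K (- v) f"] K_inv(1)[of v f] d(3) by (simp add: b_def cong_def)
  then have "h' b = f" using gh' b d by simp
  ultimately have "map_prod (g' \<circ> g) (h' \<circ> h) (0, 0) = d" using d by simp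
  then show ?thesis using commuting_comp[OF gh(1) gh'(1)] by blast
qed

lemma commuting_to_zero:
  assumes "d \<in> V \<times> F"
  shows "\<exists>g h. commuting g h \<and> map_prod g h d = (0, 0)"
proof -
  obtain v f where d: "d = (v, f)" "v \<in> V" "f \<in> F" using assms by auto
  \<comment> \<open>Only non-negative powers are at hand, so the way back to 0 uses the complements
    \<open>p - v\<close> and \<open>q - h f\<close>.\<close>
  obtain g h where gh: "commuting g h" "\<forall>w\<in>V. g w = (w + int (nat (p - v))) mod p"
    using commuting_X_pow by blast
  have b: "h f \<in> F" using gh(1) d by (simp add: commuting_def)
  obtain g' h' where gh': "commuting g' h'" "\<forall>v\<in>V. g' v = Pi (int (nat (q - h f))) v mod p"
      "\<forall>w\<in>F. h' w = (w + int (nat (q - h f))) mod q"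
    using commuting_Y_pow by blast
  have "g v = 0" using gh d by auto
  moreover have "g' 0 = 0" using gh' zero_in Pi_fix by (auto simp: cong_def)
  moreover have "h' (h f) = 0" using gh'(3) b by auto
  ultimately have "map_prod (g' \<circ> g) (h' \<circ> h) d = (0, 0)" using d by simp
  then show ?thesis using commuting_comp[OF gh(1) gh'(1)] by blast
qed

lemma commuting_transitive:
  assumes "d \<in> V \<times> F" "d' \<in> V \<times> F"
  shows "\<exists>g h. commuting g h \<and> map_prod g h d = d'"
proof -
  obtain g h where gh: "commuting g h" "map_prod g h d = (0, 0)" using commuting_to_zero assms by blast
  obtain g' h' where gh': "commuting g' h'" "map_prod g' h' (0, 0) = d'" using commuting_from_zero assms by blast
  have "map_prod (g' \<circ> g) (h' \<circ> h) d = d'" using gh gh' by (cases d) auto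
  then show ?thesis using commuting_comp[OF gh(1) gh'(1)] by blast
qed

section \<open>The base dart, and \<open>opp\<close> as an involution\<close>

lemma sg_0_0: "sg 0 0 = 1" and ri_0_0: "ri 0 0 = q - 1"
proof -
  have "[Pi 0 (Pi 0 0 + 1) = 1] (mod p)"
    using cong_trans[OF Pi_0[of "Pi 0 0 + 1"] cong_add[OF Pi_0[of 0] cong_refl[of 1 p]]] by simp
  then show "sg 0 0 = 1" using p_gt by (simp add: sg_def cong_def)
  have "[K 0 (K 0 0 - 1) = q - 1] (mod q)"
    using cong_trans[OF K_0[of "K 0 0 - 1"] cong_diff[OF K_0[of 0] cong_refl[of 1 q]]]
    by (simp add: cong_def mod_simps)
  then show "ri 0 0 = q - 1" using q_gt by (simp add: ri_def cong_def zmod_minus1)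
qed

text \<open>The base dart goes to \<open>(1, -1)\<close>, and from there to
  \<open>(Pi (-1) (Pi 1 1 + 1), K 1 (K (-1) (-1) - 1))\<close>. This is \<open>(0, 0)\<close>
  because \<open>Pi 1 1 = -1\<close> and \<open>K 1 1 = -1\<close>.\<close>

lemma opp_opp_zero: "opp (opp (0, 0)) = (0, 0)"
proof -
  have m: "[q - 1 = -1] (mod q)" by (simp add: cong_def mod_simps)
  have "[Pi 1 1 + 1 = 0] (mod p)" using cong_add[OF Pi_1 cong_refl[of 1 p]] by simp
  then have "[Pi (-1) (Pi 1 1 + 1) = 0] (mod p)" using Pi_cong' Pi_fix cong_trans by blast
  then have "sg (-1) 1 = 0" by (simp add: sg_def cong_def)
  then have "sg (q - 1) 1 = 0" using sg_eqI[OF m cong_refl] by simp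
  moreover have "[K (-1) (-1) = 1] (mod q)"
    using K_cong'[OF cong_sym[OF K_1], of "-1"] K_inv(2)[of 1 1] cong_trans by blast
  then have "[K 1 (K (-1) (-1) - 1) = 0] (mod q)"
    using K_cong'[OF cong_diff[OF _ cong_refl[of 1 q]], of "K (-1) (-1)" 1 1] K_fix[of 1] cong_trans by simp
  then have "ri 1 (-1) = 0" by (simp add: ri_def cong_def)
  then have "ri 1 (q - 1) = 0" using ri_eqI[OF m cong_refl] by simp
  ultimately show ?thesis by (simp add: opp_def sg_0_0 ri_0_0)
qed

text \<open>Every dart is the image of \<open>(0, 0)\<close> under a symmetry commuting with
  \<open>opp\<close>, so the base dart decides.\<close>

lemma opp_opp:
  assumes "d \<in> V \<times> F"
  shows "opp (opp d) = d"
proof -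
  obtain g h where gh: "commuting g h" "map_prod g h (0, 0) = d" using commuting_from_zero assms by blast
  have "(0, 0) \<in> V \<times> F" using zero_in by simp
  then have "opp (opp (map_prod g h (0, 0))) = map_prod g h (opp (opp (0, 0)))"
    using gh(1) opp_in unfolding commuting_def by metis
  then show ?thesis using gh opp_opp_zero by simp
qed

sublocale flat_map V F opp rh
proof
  show "finite V" "finite F" "V \<noteq> {}" "F \<noteq> {}" using p_pos q_pos by auto
  show "\<exists>n. w = ((\<lambda>u. fst (opp (u, f))) ^^ n) v" if "v \<in> V" "w \<in> V" for f v w
    using sg_transitive[OF that] by (simp add: opp_def)
  show "\<exists>n. g = (rh v ^^ n) f" if "f \<in> F" "g \<in> F" for v f g
    using rh_transitive that by blast
  show "rh v (snd (opp (v, f))) = f" "snd (opp (v, rh v f)) = f" if "f \<in> F" for v f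
    using that rh_ri ri_rh F_cong_eq by (auto simp: opp_def simp del: atLeastLessThan_iff)
qed (use opp_in opp_opp rh_in rh_neq in \<open>auto simp: opp_def sg_parity simp del: atLeastLessThan_iff\<close>)

text \<open>Walking around vertex \<open>0\<close> shows that a reversing automorphism negates all faces; it also maps
  vertex \<open>1\<close> to \<open>-1\<close>, so comparing the rotations at these two vertices contradicts \<open>K_chiral\<close>.\<close>

lemma no_reversing_automorphism:
  assumes "automorphism poly \<gamma>"
  shows "flag_image \<gamma> (pos_flag (0, 0)) \<noteq> neg_flag (0, 0)"
proof
  assume rev: "flag_image \<gamma> (pos_flag (0, 0)) = neg_flag (0, 0)"
  have z: "(0, 0) \<in> V \<times> F" using zero_in by simp
  obtain g h where gh: "h ` F \<subseteq> F" "inj_on h F" "h 0 = 0"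
      "g (fst (opp (0, 0))) = fst (opp (0, rh 0 0))" "h (snd (opp (0, 0))) = rh 0 0"
      and walk: "\<And>v f. v \<in> V \<Longrightarrow> f \<in> F \<Longrightarrow> h (rh v f) = rh (g v) (h f) \<or> rh (g v) (h (rh v f)) = h f"
      and g0: "g 0 = 0"
    by (rule reversing_automorphism[OF assms z rev]) blast
  have hF: "h f \<in> F" if "f \<in> F" for f using gh(1) that by blast
  have rh0: "rh 0 f = (f + 1) mod q" for f
    using cong_trans[OF K_0[of "K 0 f + 1"] cong_add[OF K_0[of f] cong_refl[of 1 q]]]
    by (simp add: rh_def cong_def)
  have "[Pi 1 (Pi (-1) 0 + 1) = -1] (mod p)"
    using Pi_cong'[OF cong_add[OF Pi_fix[of "-1"] cong_refl[of 1 p]], of 1] Pi_1 cong_trans by simp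
  then have sg10: "sg 1 0 = p - 1" using p_gt by (simp add: sg_def cong_def zmod_minus1)
  have g1: "g 1 = p - 1" and hm1: "h (q - 1) = 1"
    using gh(4,5) q_gt by (simp_all add: opp_def sg_0_0 ri_0_0 rh0 sg10)
  have F1: "1 \<in> F" "q - 1 \<in> F" "1 \<in> V" using q_gt p_gt by auto
  have "h 1 = (h 0 + 1) mod q \<or> (h 1 + 1) mod q = h 0"
    using walk[OF zero_in] q_gt by (simp add: rh0 g0)
  \<comment> \<open>Turning forwards would send face 1 to 1, which is already the image of
    \<open>q - 1\<close>, a different face because \<open>q > 2\<close>.\<close>
  moreover have "h 1 \<noteq> h (q - 1)" using inj_onD[OF gh(2) _ F1(1,2)] q_gt by auto
  ultimately have h1: "(h 1 + 1) mod q = 0" using q_gt gh(3) hm1 by auto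
  \<comment> \<open>Two consecutive values are carried along: the image of the next face is a
    neighbour of the last image, and a turn the wrong way would repeat the image before it, against
    injectivity.\<close>
  have neg: "[h (int k mod q) = - int k] (mod q) \<and> [h (int (Suc k) mod q) = - int (Suc k)] (mod q)" for k
  proof (induction k)
    case 0
    have "[h 1 + 1 = 0] (mod q)" using h1 by (simp add: cong_def)
    then have "[h 1 = -1] (mod q)" by (simp add: cong_iff_dvd_diff)
    then show ?case using gh(3) q_gt by simp
  next
    case (Suc k)
    let ?a = "int k mod q" and ?b = "int (Suc k) mod q" and ?c = "int (Suc (Suc k)) mod q"
    have F: "?a \<in> F" "?b \<in> F" "?c \<in> F" using q_pos by auto
    have c: "rh 0 ?b = ?c" by (simp add: rh0 mod_simps add_ac)
    have "[h ?c = - int (Suc (Suc k))] (mod q)"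
      using walk[OF zero_in(1) F(2)]
    proof
      assume "h (rh 0 ?b) = rh (g 0) (h ?b)"
      then have "h ?c = (h ?b + 1) mod q" using c by (simp add: rh0 g0)
      moreover have "[h ?b + 1 = - int k] (mod q)"
        using cong_add[OF conjunct2[OF Suc] cong_refl[of 1 q]] by simp
      ultimately have "[h ?c = - int k] (mod q)" by (simp add: cong_def)
      then have "[h ?c = h ?a] (mod q)" using Suc cong_sym cong_trans by blast
      then have "h ?c = h ?a" using hF F F_cong_eq by blast
      then have "?c = ?a" by (rule inj_onD[OF gh(2) _ F(3,1)])
      then have "[int (Suc (Suc k)) = int k] (mod q)" by (simp add: cong_def)
      then have "q dvd 2" by (simp add: cong_iff_dvd_diff)
      then show ?thesis using q_gt zdvd_imp_le by fastforce
    next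
      assume "rh (g 0) (h (rh 0 ?b)) = h ?b"
      then have "(h ?c + 1) mod q = h ?b" using c by (simp add: rh0 g0)
      then have "[h ?c + 1 = h ?b] (mod q)" using mod_cong[of "h ?c + 1" q] cong_sym by metis
      then have "[h ?c + 1 = - int (Suc k)] (mod q)" using Suc cong_trans by blast
      then show ?thesis by (simp add: cong_iff_dvd_diff algebra_simps)
    qed
    then show ?case using Suc by blast
  qed
  \<comment> \<open>The successor of face -1 around vertex 1: since \<open>K (-1) (-1) = 1\<close>,
    it is \<open>K 1 (1 + 1)\<close>.\<close>
  define c where "c = K 1 2 mod q"
  have cF: "c \<in> F" using q_pos by (simp add: c_def)
  have "[h (int (nat c) mod q) = - int (nat c)] (mod q)" using neg by blast
  then have hc: "[h c = - c] (mod q)" using cF by simp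
  have m1: "[q - 1 = -1] (mod q)" by (simp add: cong_def mod_simps)
  have Km: "[K (-1) (q - 1) = 1] (mod q)"
    using K_cong'[OF cong_trans[OF m1 cong_sym[OF K_1]], of "-1"] K_inv(2)[of 1 1] cong_trans by blast
  have "[K 1 (K (-1) (q - 1) + 1) = K 1 2] (mod q)"
    using K_cong'[OF cong_add[OF Km cong_refl[of 1 q]], of 1] by simp
  then have rc: "rh 1 (q - 1) = c" by (simp add: rh_def c_def cong_def)
  have pm1: "[p - 1 = -1] (mod p)" by (simp add: cong_def mod_simps)
  have pm2: "[- (p - 1) = 1] (mod p)" by (simp add: cong_iff_dvd_diff)
  have rg: "[rh (p - 1) f = K (-1) (K 1 f + 1)] (mod q)" for f
  proof -
    have "[K (- (p - 1)) f + 1 = K 1 f + 1] (mod q)"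
      using cong_add[OF K_cong[OF pm2 cong_refl] cong_refl] .
    then show ?thesis using rh_cong[of "p - 1" f] K_cong[OF pm1] cong_trans by blast
  qed
  \<comment> \<open>Faces -1 and \<open>c\<close> are consecutive around vertex 1; their images 1
    and \<open>- c\<close> must be consecutive around vertex -1. One order gives
    \<open>c = 0\<close> and hence \<open>2 = 0\<close> modulo \<open>q\<close>, the other gives
    \<open>K 1 (- K 1 2) = -2\<close>.\<close>
  from walk[OF F1(3) F1(2)] show False
  proof
    assume "h (rh 1 (q - 1)) = rh (g 1) (h (q - 1))"
    then have "h c = rh (p - 1) 1" using rc g1 hm1 by simp
    moreover have "[K 1 1 + 1 = 0] (mod q)" using cong_add[OF K_1 cong_refl[of 1 q]] by simp
    then have "[K (-1) (K 1 1 + 1) = 0] (mod q)" using K_cong' K_fix cong_trans by blast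
    ultimately have "[h c = 0] (mod q)" using rg[of 1] cong_trans by metis
    then have "h c = h 0" using F_cong_eq hF cF zero_in gh(3) by metis
    then have "c = 0" by (rule inj_onD[OF gh(2) _ cF zero_in(2)])
    then have "[K 1 2 = 0] (mod q)" by (simp add: c_def cong_def)
    then have "[K (-1) (K 1 2) = 0] (mod q)" using K_cong' K_fix cong_trans by blast
    then have "[2 = 0] (mod q)" using K_inv(2)[of 1 2] cong_sym cong_trans by blast
    then show False using q_gt by (simp add: cong_def)
  next
    assume "rh (g 1) (h (rh 1 (q - 1))) = h (q - 1)"
    then have "rh (p - 1) (h c) = 1" using rc g1 hm1 by simp
    then have "[K (-1) (K 1 (h c) + 1) = 1] (mod q)" using rg[of "h c"] cong_sym by simp
    then have "[K 1 (K (-1) (K 1 (h c) + 1)) = -1] (mod q)" using K_cong' K_1 cong_trans by blast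
    then have "[K 1 (h c) + 1 = -1] (mod q)" using K_inv(1)[of 1] cong_sym cong_trans by blast
    then have "[K 1 (h c) = -2] (mod q)" by (simp add: cong_iff_dvd_diff algebra_simps)
    moreover have "[h c = - K 1 2] (mod q)"
      using hc by (simp add: c_def cong_def mod_simps)
    ultimately have "[K 1 (- K 1 2) = -2] (mod q)"
      using K_cong'[of "- K 1 2" "h c" 1] cong_sym cong_trans by blast
    then show False using K_chiral by simp
  qed
qed

lemma chiral_polyhedron:
  "abstract_polyhedron poly" "chiral poly" "tight_of_type poly (nat p) (nat q)"
proof -
  show "abstract_polyhedron poly" by (rule abstract_polyhedron_poly)
  have "commuting g h = map_aut g h" for g h unfolding commuting_def map_aut_def ..
  then have "\<exists>g h. map_aut g h \<and> map_prod g h d = d'" if "d \<in> V \<times> F" "d' \<in> V \<times> F" for d d'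
    using commuting_transitive[OF that] by simp
  then show "chiral poly"
    using chiral_poly[of "(0, 0)"] no_reversing_automorphism zero_in by (metis mem_Sigma_iff)
  show "tight_of_type poly (nat p) (nat q)" using tight_poly by simp
qed

end

section \<open>Duality\<close>

definition dual :: "'a ranked_poset \<Rightarrow> 'a ranked_poset" where
  "dual P = \<lparr>elems = elems P, le_rel = (le_rel P)\<inverse>, rk = \<lambda>x. 2 - rk P x\<rparr>"

definition flip :: "'a \<times> 'a \<times> 'a \<Rightarrow> 'a \<times> 'a \<times> 'a" where
  "flip \<Phi> = (case \<Phi> of (v, e, f) \<Rightarrow> (f, e, v))"

lemma flip_flip [simp]: "flip (flip \<Phi>) = \<Phi>"
  by (simp add: flip_def split: prod.splits)

lemma inj_flip: "inj flip"
  by (metis flip_flip injI)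

lemma flip_image_iff: "\<Phi> \<in> flip ` C \<longleftrightarrow> flip \<Phi> \<in> C"
  by (metis flip_flip image_iff)

lemma incident_commute: "incident P x y \<longleftrightarrow> incident P y x"
  unfolding incident_def by blast

lemma dual_simps [simp]:
  "elems (dual P) = elems P" "incident (dual P) = incident P" "neighbours (dual P) = neighbours P"
  "induced_connected (dual P) = induced_connected P"
proof -
  show "elems (dual P) = elems P" by (simp add: dual_def)
  show i: "incident (dual P) = incident P" by (auto simp: fun_eq_iff incident_def dual_def)
  show n: "neighbours (dual P) = neighbours P" by (auto simp: fun_eq_iff neighbours_def i) (simp_all add: dual_def)
  show "induced_connected (dual P) = induced_connected P" by (simp add: fun_eq_iff induced_connected_def n)
qed

context
  fixes P :: "'a ranked_poset"
  assumes P: "abstract_polyhedron P"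
begin

lemma rk_cases: "x \<in> elems P \<Longrightarrow> rk P x \<in> {0, 1, 2}"
  using P by (simp add: abstract_polyhedron_def)

lemma verts_dual: "verts (dual P) = faces P" and faces_dual: "faces (dual P) = verts P"
  and edges_dual: "edges (dual P) = edges P"
  unfolding verts_def faces_def edges_def using rk_cases by (fastforce simp: dual_def)+

lemma abstract_polyhedron_dual: "abstract_polyhedron (dual P)"
proof -
  have "rk (dual P) x \<in> {0, 1, 2}" for x by (auto simp: dual_def)
  moreover have "rk (dual P) x < rk (dual P) y" if "(x, y) \<in> le_rel (dual P)" "x \<noteq> y" for x y
  proof -
    have yx: "(y, x) \<in> le_rel P" using that by (simp add: dual_def)
    then have "rk P y < rk P x" using P that by (simp add: abstract_polyhedron_def)
    \<comment> \<open>Membership bounds the larger rank \<open>rk P x\<close> by 2, so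
      \<open>2 - rk P x\<close> is not truncated and the strict inequality is reversed.\<close>
    moreover have "x \<in> elems P"
      using yx P by (auto simp: abstract_polyhedron_def partial_order_on_def preorder_on_def)
    ultimately show ?thesis using rk_cases[of x] by (auto simp: dual_def)
  qed
  moreover have "partial_order_on (elems P) (le_rel (dual P))"
    using P by (simp add: dual_def abstract_polyhedron_def)
  moreover have "\<forall>e\<in>edges P. card {v \<in> faces P. incident P v e} = 2 \<and> card {f \<in> verts P. incident P e f} = 2"
  proof
    fix e assume e: "e \<in> edges P"
    have "{v \<in> faces P. incident P v e} = {v \<in> faces P. incident P e v}"
      "{f \<in> verts P. incident P e f} = {f \<in> verts P. incident P f e}" using incident_commute by fast+
    then show "card {v \<in> faces P. incident P v e} = 2 \<and> card {f \<in> verts P. incident P e f} = 2"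
      using P e by (simp add: abstract_polyhedron_def)
  qed
  moreover have "\<forall>v\<in>faces P. \<forall>f\<in>verts P. incident P v f \<longrightarrow>
      card {e \<in> edges P. incident P v e \<and> incident P e f} = 2"
  proof (intro ballI impI)
    fix v f assume vf: "v \<in> faces P" "f \<in> verts P" "incident P v f"
    have "{e \<in> edges P. incident P v e \<and> incident P e f} = {e \<in> edges P. incident P f e \<and> incident P e v}"
      using incident_commute by fast
    moreover have "incident P f v" using vf incident_commute by fast
    ultimately show "card {e \<in> edges P. incident P v e \<and> incident P e f} = 2"
      using P vf by (simp add: abstract_polyhedron_def)
  qed
  moreover have "induced_connected P (elems P)"
    "\<forall>x\<in>faces P \<union> verts P. induced_connected P (neighbours P x)"
    using P unfolding abstract_polyhedron_def by blast+
  ultimately show ?thesis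
    unfolding abstract_polyhedron_def verts_dual faces_dual edges_dual dual_simps by blast
qed

section \<open>Flags, automorphisms and chirality of the dual\<close>

lemma flags_dual: "flags (dual P) = flip ` flags P"
proof -
  have "\<Phi> \<in> flags (dual P) \<longleftrightarrow> flip \<Phi> \<in> flags P" for \<Phi>
    unfolding flags_def verts_dual faces_dual edges_dual dual_simps
    by (cases \<Phi>) (auto simp: flip_def incident_commute)
  then show ?thesis by (intro set_eqI) (simp only: flip_image_iff)
qed

lemma automorphism_dual: "automorphism (dual P) g \<longleftrightarrow> automorphism P g"
proof -
  have "rk (dual P) (g x) = rk (dual P) x \<longleftrightarrow> rk P (g x) = rk P x"
    if "bij_betw g (elems P) (elems P)" "x \<in> elems P" for x
    using rk_cases[OF that(2)] rk_cases[OF bij_betw_apply[OF that]] by (auto simp: dual_def)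
  then show ?thesis unfolding automorphism_def dual_simps by blast
qed

lemma transitive_on_flags_dual: "transitive_on_flags (dual P) (flip ` C) \<longleftrightarrow> transitive_on_flags P C"
proof -
  have eq: "flag_image g (flip \<Phi>) = flip \<Psi> \<longleftrightarrow> flag_image g \<Phi> = \<Psi>" for g \<Phi> \<Psi>
    by (cases \<Phi>; cases \<Psi>) (auto simp: flag_image_def flip_def)
  show ?thesis unfolding transitive_on_flags_def by (simp add: automorphism_dual eq)
qed

lemma adjacent_flags_dual:
  assumes "adjacent_flags (dual P) i \<Phi> \<Psi>" "i \<le> 2"
  shows "adjacent_flags P (2 - i) (flip \<Phi>) (flip \<Psi>)"
proof -
  have fl: "flip \<Phi> \<in> flags P" "flip \<Psi> \<in> flags P"
    using assms by (auto simp: adjacent_flags_def flags_dual)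
  have flip: "flag_elem (flip \<Xi>) j = flag_elem \<Xi> (2 - j)" if "j \<le> 2" for \<Xi> :: "'a \<times> 'a \<times> 'a" and j
  proof -
    have "j = 0 \<or> j = 1 \<or> j = 2" using that by linarith
    then show ?thesis by (cases \<Xi>) (auto simp: flip_def numeral_2_eq_2)
  qed
  have "flag_elem (flip \<Phi>) j \<noteq> flag_elem (flip \<Psi>) j \<longleftrightarrow> j = 2 - i" if "j \<le> 2" for j
  proof -
    have "flag_elem \<Phi> (2 - j) \<noteq> flag_elem \<Psi> (2 - j) \<longleftrightarrow> 2 - j = i"
      using assms(1) by (simp add: adjacent_flags_def)
    then show ?thesis using that assms(2) by (simp add: flip) linarith
  qed
  then show ?thesis using fl by (simp add: adjacent_flags_def)
qed

lemma chiral_dual: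
  assumes "chiral P"
  shows "chiral (dual P)"
proof -
  obtain A B where AB: "A \<union> B = flags P" "A \<inter> B = {}"
    "\<And>i \<Phi> \<Psi>. i \<le> 2 \<Longrightarrow> adjacent_flags P i \<Phi> \<Psi> \<Longrightarrow> \<Phi> \<in> A \<and> \<Psi> \<in> B \<or> \<Phi> \<in> B \<and> \<Psi> \<in> A"
    "transitive_on_flags P A" "transitive_on_flags P B" "\<not> transitive_on_flags P (flags P)"
    using assms unfolding chiral_def by blast
  show ?thesis unfolding chiral_def
  proof (rule exI[of _ "flip ` A"], rule exI[of _ "flip ` B"], intro conjI allI impI)
    show "flip ` A \<union> flip ` B = flags (dual P)" using AB(1) by (simp add: flags_dual image_Un[symmetric])
    show "flip ` A \<inter> flip ` B = {}" using AB(2) by (simp add: image_Int[OF inj_flip, symmetric])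
    show "\<not> transitive_on_flags (dual P) (flags (dual P))"
      using AB(6) by (simp add: flags_dual transitive_on_flags_dual)
    fix i \<Phi> \<Psi> assume "i \<le> (2::nat)" "adjacent_flags (dual P) i \<Phi> \<Psi>"
    then show "\<Phi> \<in> flip ` A \<and> \<Psi> \<in> flip ` B \<or> \<Phi> \<in> flip ` B \<and> \<Psi> \<in> flip ` A"
      unfolding flip_image_iff using AB(3)[of "2 - i" "flip \<Phi>" "flip \<Psi>"] adjacent_flags_dual[of i \<Phi> \<Psi>] by simp
  qed (use AB(4,5) transitive_on_flags_dual in auto)
qed

lemma tight_dual:
  assumes "tight_of_type P p q"
  shows "tight_of_type (dual P) q p"
proof -
  have "card (flags (dual P)) = card (flags P)"
    using card_image[OF inj_on_subset[OF inj_flip subset_UNIV]] by (simp add: flags_dual)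
  moreover have "of_type (dual P) q p"
    using assms unfolding tight_of_type_def of_type_def verts_dual faces_dual edges_dual dual_simps
    by (auto simp: incident_commute[of P _])
  ultimately show ?thesis using assms by (simp add: tight_of_type_def flags_dual mult_ac)
qed

end

section \<open>The actions modulo \<open>32 s\<close>\<close>

text \<open>Closed forms of the powers \<open>\<kappa>\<^sup>v f\<close> and \<open>\<pi>\<^sup>f a\<close>. For \<open>p = 8\<close>, \<open>s = 1\<close> they describe the group with
  \<open>y\<inverse>x = x\<^sup>3y\<^sup>9\<close>.\<close>

definition face_action :: "int \<Rightarrow> int \<Rightarrow> int \<Rightarrow> int" where
  "face_action s v f = (if even v then f - 4 * s * v * f else - f + 4 * s * f * (v - f))"

definition vertex_action :: "int \<Rightarrow> int \<Rightarrow> int \<Rightarrow> int" where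
  "vertex_action s f a = (if even a then a + 4 * s * f * a else a - 2 * f - 4 * s * f * (a - f))"

text \<open>The laws below are proved by expanding both sides and exhibiting the exact quotient of
  their difference, which leaves a polynomial identity.\<close>

lemma cong_witness: "a - b = m * k \<Longrightarrow> [a = b] (mod m)" for a b m k :: int
  by (simp add: cong_iff_dvd_diff)

text \<open>One of \<open>f\<close> and \<open>a - f\<close> is even. So
  \<open>4 * s * f * (a - f)\<close> has the form \<open>8 * s * t\<close>, and its product with a
  further \<open>4 * s\<close> vanishes modulo \<open>32 * s\<close>.\<close>

lemma even_odd_prod:
  fixes a f :: int
  assumes "odd a"
  shows "\<exists>t. f * (a - f) = 2 * t"
proof -
  have "even (f * (a - f))" using assms by auto
  then show ?thesis by (rule dvdE) blast
qed

section \<open>Parity, and the laws of the face action\<close>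

lemma even_vertex_action: "even (vertex_action s f a) \<longleftrightarrow> even a"
  by (auto simp: vertex_action_def)

lemma even_face_action: "even (face_action s v f) \<longleftrightarrow> even f"
  by (auto simp: face_action_def)

text \<open>Apart from its parity, \<open>v\<close> enters only with the factor \<open>4 * s\<close>
  and so counts modulo 8; the face action thus fits every \<open>p\<close> divisible by 8.\<close>

lemma face_action_cong:
  assumes "[v = w] (mod 8)" "[f = g] (mod 32 * s)"
  shows "[face_action s v f = face_action s w g] (mod 32 * s)"
proof -
  obtain k where k: "v = w + 8 * k"
    using assms(1) by (metis add.commute cong_iff_lin cong_sym)
  obtain l where l: "f = g + 32 * s * l"
    using assms(2) by (metis add.commute cong_iff_lin cong_sym)
  have ev: "even v \<longleftrightarrow> even w" using k by simp
  show ?thesis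
  proof (cases "even v")
    case True
    have "face_action s v f - face_action s w g = 32 * s * (l - 4 * s * v * l - k * g)"
      using True ev by (simp add: face_action_def k l algebra_simps)
    then show ?thesis by (rule cong_witness)
  next
    case False
    have "face_action s v f - face_action s w g
        = 32 * s * (- l + 4 * s * l * (v - f) + g * (k - 4 * s * l))"
      using False ev by (simp add: face_action_def k l algebra_simps)
    then show ?thesis by (rule cong_witness)
  qed
qed

lemma face_action_add:
  "[face_action s (v + w) f = face_action s v (face_action s w f)] (mod 32 * s)"
proof (cases "even v")
  case True
  then obtain a where a: "v = 2 * a" by blast
  show ?thesis
  proof (cases "even w")
    case True
    then obtain b where b: "w = 2 * b" by blast
    have "face_action s (v + w) f - face_action s v (face_action s w f) = 32 * s * (- 2 * s * a * b * f)"
      by (simp add: face_action_def a b algebra_simps)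
    then show ?thesis by (rule cong_witness)
  next
    case False
    have "face_action s (v + w) f - face_action s v (face_action s w f) = 32 * s * (s * a * f * (w - f))"
      using False by (simp add: face_action_def a algebra_simps)
    then show ?thesis by (rule cong_witness)
  qed
next
  case odd: False
  show ?thesis
  proof (cases "even w")
    case True
    then obtain b where b: "w = 2 * b" by blast
    have "face_action s (v + w) f - face_action s v (face_action s w f)
        = 32 * s * (- s * b * f * f + s * b * f * (v - f + 8 * s * b * f))"
      using odd by (simp add: face_action_def b algebra_simps)
    then show ?thesis by (rule cong_witness)
  next
    case False
    then obtain t where t: "f * (w - f) = 2 * t" using even_odd_prod by blast
    have g: "face_action s w f = - f + 8 * s * t" using False t by (simp add: face_action_def mult.assoc)
    have "face_action s (v + w) f - face_action s v (face_action s w f)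
        = f - 4 * s * (v + w) * f - (f - 8 * s * t + 4 * s * (8 * s * t - f) * (v + f - 8 * s * t))"
      unfolding g using odd False by (simp add: face_action_def algebra_simps)
    also have "\<dots> = 4 * s * (2 * t - f * (w - f)) - 32 * s * (s * t * (2 * f + v - 8 * s * t))"
      by (simp add: algebra_simps)
    also have "\<dots> = 32 * s * (- s * t * (2 * f + v - 8 * s * t))" using t by simp
    finally show ?thesis by (rule cong_witness)
  qed
qed

text \<open>\<pi> fixes an even \<open>v\<close> modulo 8, so \<open>K_skew\<close> keeps the
  exponent. The case \<open>f = 0\<close> forces the shift to be
  \<open>face_action s (- v) 1\<close>.\<close>

lemma face_action_skew_even:
  assumes "even v"
  shows "[face_action s v f + 1 = face_action s v (f + (1 + 4 * s * v))] (mod 32 * s)"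
proof -
  obtain a where a: "v = 2 * a" using assms by blast
  have "face_action s v f + 1 - face_action s v (f + (1 + 4 * s * v)) = 32 * s * (2 * s * a * a)"
    by (simp add: face_action_def a algebra_simps)
  then show ?thesis by (rule cong_witness)
qed

text \<open>For odd \<open>v\<close>, \<pi> gives \<open>v - 2\<close> modulo 8, and the shift is
  \<open>face_action s (2 - v) 1\<close>.\<close>

lemma face_action_skew_odd:
  assumes "odd v"
  shows "[face_action s v f + 1 = face_action s (v - 2) (f + (- 1 - 4 * s * (v - 1)))] (mod 32 * s)"
proof -
  obtain a where a: "v = 2 * a + 1" using assms by (rule oddE)
  have "face_action s v f + 1 - face_action s (v - 2) (f + (- 1 - 4 * s * (v - 1)))
      = 32 * s * (- s * (a * (f - 1) - a * (v - 1 - f + 8 * s * a)))"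
    by (simp add: face_action_def a algebra_simps)
  then show ?thesis by (rule cong_witness)
qed

text \<open>The two sides differ by an odd multiple of \<open>16 * s\<close>, half of the
  modulus.\<close>

lemma face_action_chiral:
  assumes "s > 0"
  shows "\<not> [face_action s 1 (- face_action s 1 2) = -2] (mod 32 * s)"
proof
  assume "[face_action s 1 (- face_action s 1 2) = -2] (mod 32 * s)"
  moreover have "face_action s 1 (- face_action s 1 2) - (-2) = 16 * s * (- (1 + 6 * s + 16 * s * s))"
    by (simp add: face_action_def algebra_simps)
  ultimately have "16 * s * 2 dvd 16 * s * (- (1 + 6 * s + 16 * s * s))"
    by (simp add: cong_iff_dvd_diff)
  then have "16 * s = 0 \<or> even (- (1 + 6 * s + 16 * s * s))" by (simp only: dvd_mult_cancel_left)
  then show False using assms by simp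
qed

section \<open>The laws of the vertex action\<close>

lemma vertex_action_cong:
  assumes "even m" "[f = g] (mod m)" "[a = b] (mod m)"
  shows "[vertex_action s f a = vertex_action s g b] (mod m)"
proof -
  have "even a \<longleftrightarrow> even b" using assms(1,3) by (meson cong_dvd_iff cong_dvd_modulus)
  then show ?thesis
    unfolding vertex_action_def by (auto intro!: cong_add cong_diff cong_mult assms)
qed

lemma vertex_action_add:
  "[vertex_action s (f + g) a = vertex_action s f (vertex_action s g a)] (mod 32 * s)"
proof (cases "even a")
  case True
  then obtain b where b: "a = 2 * b" by blast
  have "vertex_action s (f + g) a - vertex_action s f (vertex_action s g a) = 32 * s * (- s * f * g * b)"
    by (simp add: vertex_action_def b algebra_simps)
  then show ?thesis by (rule cong_witness)
next
  case False
  then obtain t where t: "g * (a - g) = 2 * t" using even_odd_prod by blast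
  have "vertex_action s (f + g) a - vertex_action s f (vertex_action s g a) = - 16 * s * s * f * (g * (a - g))"
    using False by (simp add: vertex_action_def algebra_simps)
  also have "\<dots> = 32 * s * (- s * f * t)" unfolding t by simp
  finally show ?thesis by (rule cong_witness)
qed

text \<open>The case \<open>a = 0\<close> forces the shift: it is the value at 1 of the vertex
  action with exponent \<open>- face_action s 1 f\<close>, reduced modulo
  \<open>32 * s\<close>.\<close>

lemma vertex_action_skew:
  "[vertex_action s f a + 1 =
    vertex_action s (face_action s 1 f) (a + (1 - 2 * f + 4 * s * (f * (1 - f))))] (mod 32 * s)"
proof -
  obtain t where t: "f * (1 - f) = 2 * t" using even_odd_prod[of 1] by auto
  have k: "face_action s 1 f = - f + 8 * s * t" using t by (simp add: face_action_def mult.assoc)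
  show ?thesis
  proof (cases "even a")
    case True
    have "vertex_action s f a + 1 - vertex_action s (- f + 8 * s * t) (a + (1 - 2 * f + 4 * s * (2 * t)))
        = 4 * s * (2 * t - f * (1 - f)) + 32 * s * (s * t * (a + 1 - f))"
      using True by (simp add: vertex_action_def algebra_simps)
    also have "\<dots> = 32 * s * (s * t * (a + 1 - f))" using t by simp
    finally show ?thesis unfolding k t by (rule cong_witness)
  next
    case False
    have "vertex_action s f a + 1 - vertex_action s (- f + 8 * s * t) (a + (1 - 2 * f + 4 * s * (2 * t)))
        = 4 * s * (f * (1 - f) - 2 * t) + 32 * s * (s * t * (f - (a + 1 - 2 * f + 8 * s * t)))"
      using False by (simp add: vertex_action_def algebra_simps)
    also have "\<dots> = 32 * s * (s * t * (f - (a + 1 - 2 * f + 8 * s * t)))" using t by simp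
    finally show ?thesis unfolding k t by (rule cong_witness)
  qed
qed

section \<open>Tight chiral polyhedra of type \<open>{8 r, 32 s}\<close>\<close>

text \<open>Vertices split into residues modulo \<open>M\<close> and modulo \<open>R\<close>.
  \<open>M dvd 32 * s\<close> transfers the laws of the vertex action to the modulus
  \<open>M\<close>, and \<open>8 dvd M\<close> makes the face action well defined on
  vertices.\<close>

lemma reciprocal_actions_exist:
  fixes M R s :: int
  assumes M: "8 dvd M" "M dvd 32 * s" "M > 0" and R: "R > 0" "coprime M R" and s: "s > 0"
  shows "\<exists>Pi. reciprocal_actions (M * R) (32 * s) Pi (face_action s)"
proof -
  \<comment> \<open>The idempotent separating the two factors: \<open>Pi f\<close> becomes the
    vertex action modulo \<open>M\<close> and the \<open>f\<close>-th power of negation modulo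
    \<open>R\<close>.\<close>
  obtain \<eta> where \<eta>: "[\<eta> = 1] (mod M)" "[\<eta> = 0] (mod R)"
    using binary_chinese_remainder_int[OF R(2)] by blast
  define sgn where "sgn f = (if even f then 1 else - 1 :: int)" for f :: int
  define Pi where "Pi f a = \<eta> * vertex_action s f a + (1 - \<eta>) * (sgn f * a)" for f a
  have even_M: "even M" using dvd_trans[OF _ M(1), of 2] by simp
  have Pi_M: "[Pi f a = vertex_action s f a] (mod M)" for f a
  proof -
    have "[Pi f a = 1 * vertex_action s f a + (1 - 1) * (sgn f * a)] (mod M)"
      unfolding Pi_def by (intro cong_add cong_mult cong_diff \<eta> cong_refl)
    then show ?thesis by simp
  qed
  have Pi_R: "[Pi f a = sgn f * a] (mod R)" for f a
  proof -
    have "[Pi f a = 0 * vertex_action s f a + (1 - 0) * (sgn f * a)] (mod R)"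
      unfolding Pi_def by (intro cong_add cong_mult cong_diff \<eta> cong_refl)
    then show ?thesis by simp
  qed
  have combine: "[x = y] (mod M * R)" if "[x = y] (mod M)" "[x = y] (mod R)" for x y
    using coprime_cong_mult[OF that R(2)] .
  have down: "[x = y] (mod M)" "[x = y] (mod R)" if "[x = y] (mod M * R)" for x y
    using that by (auto intro: cong_dvd_modulus)
  have down_M: "[x = y] (mod M)" if "[x = y] (mod 32 * s)" for x y
    using that M(2) cong_dvd_modulus by blast
  have parity: "even (Pi f a) \<longleftrightarrow> even a" for f a
    using cong_dvd_iff[OF cong_dvd_modulus[OF Pi_M even_M]] even_vertex_action by blast
  have sgn_add: "sgn (f + g) = sgn f * sgn g" and sgn_sq: "sgn f * sgn f = 1" for f g
    by (auto simp: sgn_def)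
  \<comment> \<open>\<open>Pi 1 v\<close> enters \<open>K_skew\<close> as an exponent of the face
    action, which counts modulo 8, a divisor of \<open>M\<close>.\<close>
  have Pi_8: "[Pi 1 v = vertex_action s 1 v] (mod 8)" for v
    using cong_dvd_modulus[OF Pi_M M(1)] .
  have "reciprocal_actions (M * R) (32 * s) Pi (face_action s)"
  proof
    have "M \<ge> 8" using M by (simp add: zdvd_imp_le)
    then have "8 * 1 \<le> M * R" using R(1) by (intro mult_mono) auto
    then show "2 < M * R" by simp
    show "2 < 32 * s" using s by simp
    show "even (M * R)" using even_M by simp
  next
    fix f g a b :: int assume fg: "[f = g] (mod 32 * s)" and ab: "[a = b] (mod M * R)"
    have "[vertex_action s f a = vertex_action s g b] (mod M)"
      using vertex_action_cong[OF even_M down_M[OF fg] down(1)[OF ab]] .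
    then have "[Pi f a = Pi g b] (mod M)" using Pi_M cong_sym cong_trans by meson
    moreover have "[f = g] (mod 2)" using fg by (rule cong_dvd_modulus) simp
    then have "sgn f = sgn g" unfolding sgn_def using cong_dvd_iff by metis
    then have "[sgn f * a = sgn g * b] (mod R)" using down(2)[OF ab] by (simp add: cong_scalar_left)
    then have "[Pi f a = Pi g b] (mod R)" using Pi_R cong_sym cong_trans by meson
    ultimately show "[Pi f a = Pi g b] (mod M * R)" by (rule combine)
  next
    fix a :: int
    have "Pi 0 a = a" by (simp add: Pi_def vertex_action_def sgn_def algebra_simps)
    then show "[Pi 0 a = a] (mod M * R)" by simp
  next
    fix f g a :: int
    have "[vertex_action s f (vertex_action s g a) = vertex_action s f (Pi g a)] (mod M)"
      by (intro vertex_action_cong even_M cong_refl cong_sym[OF Pi_M])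
    then have "[vertex_action s (f + g) a = Pi f (Pi g a)] (mod M)"
      using cong_trans[OF down_M[OF vertex_action_add]] cong_trans[OF _ cong_sym[OF Pi_M]] by meson
    then have "[Pi (f + g) a = Pi f (Pi g a)] (mod M)" by (rule cong_trans[OF Pi_M])
    moreover have "[sgn f * (sgn g * a) = sgn f * Pi g a] (mod R)"
      by (intro cong_mult cong_refl cong_sym[OF Pi_R])
    then have "[sgn (f + g) * a = Pi f (Pi g a)] (mod R)"
      using cong_trans[OF _ cong_sym[OF Pi_R]] by (simp add: sgn_add mult.assoc)
    then have "[Pi (f + g) a = Pi f (Pi g a)] (mod R)" by (rule cong_trans[OF Pi_R])
    ultimately show "[Pi (f + g) a = Pi f (Pi g a)] (mod M * R)" by (rule combine)
  next
    fix f :: int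
    show "[Pi f 0 = 0] (mod M * R)" by (simp add: Pi_def vertex_action_def)
  next
    show "[Pi 1 1 = -1] (mod M * R)"
      using Pi_M[of 1 1] Pi_R[of 1 1] by (intro combine) (auto simp: vertex_action_def sgn_def)
  next
    fix f a show "even (Pi f a) \<longleftrightarrow> even a" by (rule parity)
  next
    fix f :: int
    let ?k = "face_action s 1 f"
    let ?e = "1 - 2 * f + 4 * s * (f * (1 - f))"
    \<comment> \<open>Modulo \<open>M\<close> the shift is that of
      \<open>vertex_action_skew\<close>; modulo \<open>R\<close> it is \<open>sgn f\<close>, since
      \<open>sgn f * a + 1 = sgn f * (a + sgn f)\<close>.\<close>
    obtain e where e: "[e = ?e] (mod M)" "[e = sgn f] (mod R)"
      using binary_chinese_remainder_int[OF R(2)] by blast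
    have "[Pi f a + 1 = Pi ?k (a + e)] (mod M * R)" for a
    proof (rule combine)
      have "[Pi f a + 1 = vertex_action s f a + 1] (mod M)" by (rule cong_add1[OF Pi_M])
      also have "[vertex_action s f a + 1 = vertex_action s ?k (a + ?e)] (mod M)"
        by (rule down_M[OF vertex_action_skew])
      also have "[vertex_action s ?k (a + ?e) = vertex_action s ?k (a + e)] (mod M)"
        by (intro vertex_action_cong even_M cong_refl cong_add cong_sym[OF e(1)])
      also have "[vertex_action s ?k (a + e) = Pi ?k (a + e)] (mod M)" by (rule cong_sym[OF Pi_M])
      finally show "[Pi f a + 1 = Pi ?k (a + e)] (mod M)" .
      have sk: "sgn ?k = sgn f" by (simp add: sgn_def even_face_action)
      have "[Pi f a + 1 = sgn f * a + 1] (mod R)" by (rule cong_add1[OF Pi_R])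
      also have "sgn f * a + 1 = sgn f * (a + sgn f)" by (simp add: distrib_left sgn_sq)
      also have "[sgn f * (a + sgn f) = sgn f * (a + e)] (mod R)"
        by (intro cong_mult cong_add cong_refl cong_sym[OF e(2)])
      also have "[sgn f * (a + e) = Pi ?k (a + e)] (mod R)"
        using cong_sym[OF Pi_R[of ?k "a + e"]] by (simp add: sk)
      finally show "[Pi f a + 1 = Pi ?k (a + e)] (mod R)" .
    qed
    then show "\<exists>e. \<forall>a. [Pi f a + 1 = Pi ?k (a + e)] (mod M * R)" by blast
  next
    fix v w f g :: int assume "[v = w] (mod M * R)" "[f = g] (mod 32 * s)"
    then show "[face_action s v f = face_action s w g] (mod 32 * s)"
      using face_action_cong cong_dvd_modulus[OF down(1) M(1)] by blast
  next
    fix v w f :: int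
    show "[face_action s (v + w) f = face_action s v (face_action s w f)] (mod 32 * s)"
      by (rule face_action_add)
  next
    fix v :: int
    show "\<exists>e. \<forall>f. [face_action s v f + 1 = face_action s (Pi 1 v) (f + e)] (mod 32 * s)"
    proof (cases "even v")
      case True
      then obtain b where b: "v = 2 * b" by blast
      have "[Pi 1 v = v] (mod 8)"
        using Pi_8[of v] by (rule cong_trans) (simp add: vertex_action_def b cong_iff_dvd_diff)
      then have "[face_action s v f + 1 = face_action s (Pi 1 v) (f + (1 + 4 * s * v))] (mod 32 * s)" for f
        using cong_trans[OF face_action_skew_even[OF True] face_action_cong[OF cong_sym cong_refl]] by blast
      then show ?thesis by blast
    next
      case False
      then obtain b where b: "v = 2 * b + 1" by (rule oddE)
      have "[Pi 1 v = v - 2] (mod 8)"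
        using Pi_8[of v] by (rule cong_trans) (simp add: vertex_action_def b cong_iff_dvd_diff)
      then have "[face_action s v f + 1
          = face_action s (Pi 1 v) (f + (- 1 - 4 * s * (v - 1)))] (mod 32 * s)" for f
        using cong_trans[OF face_action_skew_odd[OF False] face_action_cong[OF cong_sym cong_refl]] by blast
      then show ?thesis by blast
    qed
  qed (use face_action_chiral[OF s] in \<open>auto simp: face_action_def\<close>)
  then show ?thesis by blast
qed

section \<open>Arbitrary \<open>r\<close> and \<open>s\<close>, sorted by their 2-parts\<close>

lemma tight_chiral_polyhedron_exists:
  fixes k m s :: nat
  assumes "odd m" "s > 0" "2 ^ k dvd 4 * s"
  shows "\<exists>P :: nat ranked_poset. abstract_polyhedron P \<and> chiral P \<and>
    tight_of_type P (8 * (2 ^ k * m)) (32 * s)"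
proof -
  have "m > 0" using assms(1) by (cases m) auto
  \<comment> \<open>The 2-part \<open>8 * 2 ^ k\<close> of the first entry of the type serves as
    \<open>M\<close>, and the odd \<open>m\<close> as \<open>R\<close>.\<close>
  have "(2 :: int) ^ k dvd 4 * int s" using assms(3) by (metis int_dvd_int_iff of_nat_mult of_nat_numeral of_nat_power)
  then have "8 * 2 ^ k dvd 8 * (4 * int s)" by (rule mult_dvd_mono[OF dvd_refl])
  moreover have "coprime ((2 :: int) ^ (3 + k)) (int m)" using assms(1) by simp
  ultimately obtain Pi where "reciprocal_actions (8 * 2 ^ k * int m) (32 * int s) Pi (face_action (int s))"
    using reciprocal_actions_exist[of "8 * 2 ^ k" "int s" "int m"] \<open>m > 0\<close> \<open>s > 0\<close> by (auto simp: power_add)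
  then interpret reciprocal_actions "8 * 2 ^ k * int m" "32 * int s" Pi "face_action (int s)" .
  have "nat (8 * 2 ^ k * int m) = 8 * (2 ^ k * m)" "nat (32 * int s) = 32 * s"
    by (simp_all add: nat_mult_distrib nat_power_eq)
  then show ?thesis using chiral_polyhedron by metis
qed

lemma power2_odd_decomposition:
  assumes "n > (0 :: nat)"
  obtains k m where "n = 2 ^ k * m" "odd m"
proof -
  obtain m where "n = 2 ^ multiplicity 2 n * m" "odd m"
    using multiplicity_decompose'[of n 2] assms by auto
  then show thesis by (rule that)
qed

theorem theorem3p14:
  fixes r s :: nat
  assumes "r > 0" and "s > 0"
  shows "\<exists>P :: nat ranked_poset. abstract_polyhedron P \<and> chiral P \<and> tight_of_type P (8 * r) (32 * s)"
proof -
  obtain k m where r: "r = 2 ^ k * m" "odd m" using power2_odd_decomposition[OF assms(1)] by blast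
  obtain l n where s: "s = 2 ^ l * n" "odd n" using power2_odd_decomposition[OF assms(2)] by blast
  show ?thesis
  proof (cases "2 ^ k dvd 4 * s")
    case True
    then show ?thesis using tight_chiral_polyhedron_exists[OF r(2) assms(2)] r(1) by simp
  next
    case False
    have "l + 2 < k"
    proof (rule ccontr)
      assume "\<not> l + 2 < k"
      then have "(2::nat) ^ k dvd 2 ^ (l + 2)" by (intro le_imp_power_dvd) simp
      also have "\<dots> dvd 4 * s" by (simp add: s(1) power_add)
      finally show False using False by simp
    qed
    \<comment> \<open>Now \<open>8 * r = 32 * (2 ^ (l + j) * m)\<close> and
      \<open>32 * s = 8 * (2 ^ (l + 2) * n)\<close>. With the roles exchanged the divisibility
      condition holds, and the dual restores the order of the type.\<close>
    then obtain j where j: "k = l + 2 + j" using less_imp_add_positive by blast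
    have "4 * (2 ^ (l + j) * m) = r" by (simp add: r(1) j power_add)
    then have "(2::nat) ^ (l + 2) dvd 4 * (2 ^ (l + j) * m)" by (simp add: r(1) j power_add)
    moreover have "2 ^ (l + j) * m > 0" using r(2) by (cases m) auto
    ultimately obtain P :: "nat ranked_poset" where P: "abstract_polyhedron P" "chiral P"
      "tight_of_type P (8 * (2 ^ (l + 2) * n)) (32 * (2 ^ (l + j) * m))"
      using tight_chiral_polyhedron_exists[OF s(2)] by blast
    have eq: "8 * (2 ^ (l + 2) * n) = 32 * s" "32 * (2 ^ (l + j) * m) = 8 * r"
      by (simp_all add: r(1) s(1) j power_add)
    have "tight_of_type P (32 * s) (8 * r)" using P(3) unfolding eq .
    then show ?thesis
      using abstract_polyhedron_dual[OF P(1)] chiral_dual[OF P(1,2)] tight_dual[OF P(1)] by blast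
  qed
qed

end
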